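(* Let $T=[0,1]$, $L\ge1$ and $0<\alpha<1/3$ be given, and let $\mathcal S_n=\mathcal S_n(\zeta)$ be a grid of smoothness parameters in $[r,R]$ as described in the context. Let $s<s'$ be any two points in $\mathcal S_n(\zeta)$ (possibly depending on $n$) and suppose that $C_n$ is a confidence band that is asymptotically honest with level $\alpha$ over $$\Sigma(s')\cup\tilde\Sigma(s,\rho_n(s),\mathcal S_n),$$ and that is adaptive in the sense that $$\sup_{f\in\Sigma(s')}E_f|C_n|\le Lr_n(s'),\qquad\sup_{f\in\tilde\Sigma(s,\rho_n(s),\mathcal S_n)}E_f|C_n|\le Lr_n(s)$$ for every $n$ large enough. Then if $\zeta:=\zeta(R,B,L,\alpha)$ is a large enough but finite constant, we necessarily have $$\liminf_n\frac{\rho_n(s)}{r_n(s)}>0.$$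
   Context: Observations: $X_1,\ldots,X_n$ are i.i.d. random variables with values in $[0,1]$ and common probability density $f$; $\Pr_f$ and $E_f$ denote the joint law and the corresponding expectation. $\|\cdot\|_\infty$ is the supremum norm on $[0,1]$. $B\ge1$ and $0<r<R<\infty$ are fixed. Hölder norm: fix an $S$-regular Daubechies wavelet basis of $L^2([0,1])$ (boundary-corrected), $S>R$: scaling functions $\phi_k$, $k=1,\ldots,N$, and wavelets $\psi_{lk}=2^{l/2}\psi_k(2^l\cdot)$, $l\ge J_0$, $k=1,\ldots,2^l$, with $\phi_k,\psi_k$ compactly supported and $S$ times continuously differentiable. For continuous $f$ on $[0,1]$ put $\alpha_k(f)=\int f\phi_k$, $\beta_{lk}(f)=\int f\psi_{lk}$ and $\|f\|_{s,\infty}=\max\bigl(\sup_k|\alpha_k(f)|,\ \sup_{k,l}2^{l(s+1/2)}|\beta_{lk}(f)|\bigr)$. $\Sigma(s)=\Sigma(s,B)=\{f:[0,1]\to[0,\infty)\text{ continuous},\ \int_0^1 f=1,\ \|f\|_{s,\infty}\le B\}$. Grid: for a constant $\zeta>0$ (and $n$ large enough), $\mathcal S_n=\mathcal S_n(\zeta)=\{s_i:\ i=1,\ldots,|\mathcal S_n|\}\subset[r,R]$ with $s_1=r$, $s_{|\mathcal S_n|}=R$, $s_i<s_{i+1}$, and each point having distance at most $2\zeta/\log n$ and at least $\zeta/\log n$ to the next point; thus $|\mathcal S_n|$ is of order $\log n$. Separated classes: for nonnegative real numbers $\rho_n(s)$, $\tilde\Sigma(s,\rho_n(s),\mathcal S_n)=\{f\in\Sigma(s):\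 \inf_{g\in\Sigma(t)}\|g-f\|_\infty\ge\rho_n(s)\ \text{for all } t>s,\ t\in\mathcal S_n\}$. Rate: $r_n(s)=(\log n/n)^{s/(2s+1)}$. Confidence band: $C_n=C_n(X_1,\ldots,X_n)$ is a family of random intervals $\{C_n(y)=[c_n(y),c_n'(y)]\}_{y\in[0,1]}$ with maximal diameter $|C_n|=\sup_{y\in[0,1]}|c_n'(y)-c_n(y)|$. $\{f\in C_n\}$ means $f(y)\in C_n(y)$ for all $y\in[0,1]$. $C_n$ is asymptotically honest with level $\alpha$ for a family $\mathcal P$ of densities (possibly depending on $n$) if $\liminf_n\inf_{f\in\mathcal P}\Pr_f(f\in C_n)\ge1-\alpha$. *)

theory Defs
  imports "HOL-Probability.Probability"
begin

section \<open>Boundary-corrected Daubechies wavelets on the unit interval\<close>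

definition C_k_on :: "nat \<Rightarrow> real set \<Rightarrow> (real \<Rightarrow> real) \<Rightarrow> bool" where
  "C_k_on S A f \<longleftrightarrow> (\<exists>D :: nat \<Rightarrow> real \<Rightarrow> real.
     (\<forall>x\<in>A. D 0 x = f x) \<and>
     (\<forall>i<S. \<forall>x\<in>A. (D i has_real_derivative D (Suc i) x) (at x within A)) \<and>
     (\<forall>i\<le>S. continuous_on A (D i)))"

text \<open>
  The Daubechies filters with \<open>M\<close> vanishing moments are exactly the orthonormal filters of minimal
  length \<open>2 * M\<close> with \<open>M\<close> vanishing moments (every choice of the spectral factor is allowed).
  The translation is normalised so that the father and the mother wavelet are both supported in
  \<open>[1 - M, M]\<close>.
\<close>

definition daubechies_filter :: "nat \<Rightarrow> (int \<Rightarrow> real) \<Rightarrow> bool" where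
  "daubechies_filter M h \<longleftrightarrow>
     (\<forall>n. n \<notin> {1 - int M..int M} \<longrightarrow> h n = 0) \<and>
     (\<Sum>n=1 - int M..int M. h n) = sqrt 2 \<and>
     (\<forall>m. (\<Sum>n=1 - int M..int M. h n * h (n + 2 * m)) = (if m = 0 then 1 else 0)) \<and>
     (\<forall>j<M. (\<Sum>n=1 - int M..int M. (- 1) powi n * of_int n ^ j * h n) = 0)"

definition daubechies_pair ::
    "nat \<Rightarrow> (int \<Rightarrow> real) \<Rightarrow> (real \<Rightarrow> real) \<Rightarrow> (real \<Rightarrow> real) \<Rightarrow> bool" where
  "daubechies_pair M h \<phi> \<psi> \<longleftrightarrow>
     daubechies_filter M h \<and>
     (\<forall>x. x \<notin> {1 - real M..real M} \<longrightarrow> \<phi> x = 0) \<and>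
     (LBINT x:{1 - real M..real M}. \<phi> x) = 1 \<and>
     (\<forall>x. \<phi> x = sqrt 2 * (\<Sum>n=1 - int M..int M. h n * \<phi> (2 * x - of_int n))) \<and>
     (\<forall>x. \<psi> x = sqrt 2 * (\<Sum>n=1 - int M..int M. (- 1) powi n * h (1 - n) * \<phi> (2 * x - of_int n)))"

text \<open>
  \<open>L2_orthonormal_basis A I e\<close>: the family \<open>e i\<close>, \<open>i \<in> I\<close>, is orthonormal in \<open>L\<^sup>2(A)\<close> and its linear
  span is dense.
\<close>

definition square_integrable_on :: "real set \<Rightarrow> (real \<Rightarrow> real) \<Rightarrow> bool" where
  "square_integrable_on A f \<longleftrightarrow>
     set_borel_measurable lborel A f \<and> set_integrable lborel A (\<lambda>x. (f x)\<^sup>2)"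

definition L2_orthonormal_basis :: "real set \<Rightarrow> 'i set \<Rightarrow> ('i \<Rightarrow> real \<Rightarrow> real) \<Rightarrow> bool" where
  "L2_orthonormal_basis A I e \<longleftrightarrow>
     (\<forall>i\<in>I. square_integrable_on A (e i)) \<and>
     (\<forall>i\<in>I. \<forall>j\<in>I. (LBINT x:A. e i x * e j x) = (if i = j then 1 else 0)) \<and>
     (\<forall>f. square_integrable_on A f \<longrightarrow>
        (\<forall>\<epsilon>>0. \<exists>F a. finite F \<and> F \<subseteq> I \<and> (LBINT x:A. (f x - (\<Sum>i\<in>F. a i * e i x))\<^sup>2) < \<epsilon>))"

text \<open>
  The data of a Cohen--Daubechies--Vial system: \<open>vmoments\<close> is the number \<open>M\<close> of vanishing moments,
  \<open>coarse\<close> the coarsest resolution level \<open>J\<^sub>0\<close>, \<open>father\<close> and \<open>mother\<close> live on the whole line; the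
  left (right) edge functions, indexed by \<open>1, ..., M\<close>, live on the half line \<open>{0..}\<close> (\<open>{..0}\<close>).
\<close>

record wavelet_system =
  vmoments :: nat
  coarse :: nat
  filt :: "int \<Rightarrow> real"
  father :: "real \<Rightarrow> real"
  father_left :: "nat \<Rightarrow> real \<Rightarrow> real"
  father_right :: "nat \<Rightarrow> real \<Rightarrow> real"
  mother :: "real \<Rightarrow> real"
  mother_left :: "nat \<Rightarrow> real \<Rightarrow> real"
  mother_right :: "nat \<Rightarrow> real \<Rightarrow> real"

text \<open>
  The \<open>k\<close>-th function at level \<open>l\<close>, \<open>k = 1, ..., 2 ^ l\<close>, is \<open>2 powr (l/2)\<close> times a generator
  evaluated at \<open>2 ^ l * x\<close>: there are \<open>M\<close> left edge functions, \<open>2 ^ l - 2 * M\<close> integer translates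
  of the whole-line generator, and \<open>M\<close> right edge functions, which are anchored at \<open>x = 1\<close>.
\<close>

definition level_fun ::
    "nat \<Rightarrow> (nat \<Rightarrow> real \<Rightarrow> real) \<Rightarrow> (real \<Rightarrow> real) \<Rightarrow> (nat \<Rightarrow> real \<Rightarrow> real)
      \<Rightarrow> nat \<Rightarrow> nat \<Rightarrow> real \<Rightarrow> real" where
  "level_fun M gl g gr l k x = 2 powr (real l / 2) *
     (if k \<le> M then gl k (2 ^ l * x)
      else if k \<le> 2 ^ l - M then g (2 ^ l * x - (real k - 1))
      else gr (2 ^ l + 1 - k) (2 ^ l * x - 2 ^ l))"

definition scaling_fun :: "wavelet_system \<Rightarrow> nat \<Rightarrow> nat \<Rightarrow> real \<Rightarrow> real" where
  "scaling_fun W = level_fun (vmoments W) (father_left W) (father W) (father_right W)"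

definition wavelet_fun :: "wavelet_system \<Rightarrow> nat \<Rightarrow> nat \<Rightarrow> real \<Rightarrow> real" where
  "wavelet_fun W = level_fun (vmoments W) (mother_left W) (mother W) (mother_right W)"

definition wavelet_family :: "wavelet_system \<Rightarrow> nat \<Rightarrow> nat + nat \<times> nat \<Rightarrow> real \<Rightarrow> real" where
  "wavelet_family W J = case_sum (scaling_fun W J) (\<lambda>(l, k). wavelet_fun W l k)"

definition wavelet_indices :: "nat \<Rightarrow> (nat + nat \<times> nat) set" where
  "wavelet_indices J = {1..2 ^ J} <+> (SIGMA l:{J..}. {1..2 ^ l})"

text \<open>
  The basis condition is required from every level \<open>J \<ge> J\<^sub>0\<close> on, which expresses that the spans of
  the scaling functions form a multiresolution analysis of \<open>L\<^sup>2([0,1])\<close> whose detail spaces are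
  spanned by the wavelets. The edge scaling functions are combinations of those translates of the
  father wavelet, cut off at the end point, that are not used in the interior. The
  vanishing moments over \<open>[0,1]\<close> say that polynomials of degree \<open>< M\<close> are reproduced up to the
  boundary.
\<close>

definition boundary_corrected_daubechies :: "nat \<Rightarrow> wavelet_system \<Rightarrow> bool" where
  "boundary_corrected_daubechies S W \<longleftrightarrow>
     (let M = vmoments W in
       1 \<le> M \<and> 2 * M \<le> 2 ^ coarse W \<and>
       daubechies_pair M (filt W) (father W) (mother W) \<and>
       C_k_on S UNIV (father W) \<and> C_k_on S UNIV (mother W) \<and>
       (\<forall>k\<in>{1..M}.
          C_k_on S {0..} (father_left W k) \<and> C_k_on S {0..} (mother_left W k) \<and>
          C_k_on S {..0} (father_right W k) \<and> C_k_on S {..0} (mother_right W k) \<and>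
          (\<forall>x>2 * real M - 1. father_left W k x = 0 \<and> mother_left W k x = 0) \<and>
          (\<forall>x<1 - 2 * real M. father_right W k x = 0 \<and> mother_right W k x = 0) \<and>
          (\<exists>a. \<forall>x\<ge>0. father_left W k x = (\<Sum>m=1 - int M..int M - 1. a m * father W (x - of_int m))) \<and>
          (\<exists>a. \<forall>x\<le>0. father_right W k x = (\<Sum>m=- int M..int M - 2. a m * father W (x - of_int m)))) \<and>
       (\<forall>J\<ge>coarse W. L2_orthonormal_basis {0..1} (wavelet_indices J) (wavelet_family W J)) \<and>
       (\<forall>l\<ge>coarse W. \<forall>k\<in>{1..2 ^ l}. \<forall>j<M. (LBINT x:{0..1}. x ^ j * wavelet_fun W l k x) = 0))"


section \<open>Hoelder balls and separated classes of densities\<close>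

text \<open>
  Functions on \<open>[0,1]\<close> are represented by functions on the reals whose values outside \<open>[0,1]\<close> are
  irrelevant. Norms take values in the extended nonnegative reals, since they may be infinite.
\<close>

definition alpha_coeff :: "wavelet_system \<Rightarrow> (real \<Rightarrow> real) \<Rightarrow> nat \<Rightarrow> real" where
  "alpha_coeff W f k = (LBINT x:{0..1}. f x * scaling_fun W (coarse W) k x)"

definition beta_coeff :: "wavelet_system \<Rightarrow> (real \<Rightarrow> real) \<Rightarrow> nat \<Rightarrow> nat \<Rightarrow> real" where
  "beta_coeff W f l k = (LBINT x:{0..1}. f x * wavelet_fun W l k x)"

definition holder_norm :: "wavelet_system \<Rightarrow> real \<Rightarrow> (real \<Rightarrow> real) \<Rightarrow> ennreal" where
  "holder_norm W s f =
     max (SUP k\<in>{1..2 ^ coarse W}. ennreal \<bar>alpha_coeff W f k\<bar>)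
         (SUP (l, k)\<in>(SIGMA l:{coarse W..}. {1..2 ^ l}).
            ennreal (2 powr (real l * (s + 1 / 2)) * \<bar>beta_coeff W f l k\<bar>))"

definition sup_norm :: "(real \<Rightarrow> real) \<Rightarrow> ennreal" where
  "sup_norm f = (SUP y\<in>{0..1}. ennreal \<bar>f y\<bar>)"

definition holder_densities :: "wavelet_system \<Rightarrow> real \<Rightarrow> real \<Rightarrow> (real \<Rightarrow> real) set" where
  "holder_densities W B s =
     {f. continuous_on {0..1} f \<and> (\<forall>x\<in>{0..1}. 0 \<le> f x) \<and> (LBINT x:{0..1}. f x) = 1 \<and>
         holder_norm W s f \<le> ennreal B}"

definition separated_densities ::
    "wavelet_system \<Rightarrow> real \<Rightarrow> real \<Rightarrow> real \<Rightarrow> real set \<Rightarrow> (real \<Rightarrow> real) set" where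
  "separated_densities W B s \<rho> G =
     {f \<in> holder_densities W B s. \<forall>t\<in>G. t > s \<longrightarrow>
        (INF g\<in>holder_densities W B t. sup_norm (\<lambda>y. g y - f y)) \<ge> ennreal \<rho>}"

definition smoothness_grid :: "real \<Rightarrow> real \<Rightarrow> real \<Rightarrow> nat \<Rightarrow> real set \<Rightarrow> bool" where
  "smoothness_grid r R \<zeta> n G \<longleftrightarrow>
     (\<exists>m (\<sigma> :: nat \<Rightarrow> real). 1 \<le> m \<and> G = \<sigma> ` {1..m} \<and> \<sigma> 1 = r \<and> \<sigma> m = R \<and>
        (\<forall>i\<in>{1..<m}. \<sigma> i < \<sigma> (Suc i) \<and>
           \<zeta> / ln (real n) \<le> \<sigma> (Suc i) - \<sigma> i \<and> \<sigma> (Suc i) - \<sigma> i \<le> 2 * \<zeta> / ln (real n)))"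

definition rate :: "nat \<Rightarrow> real \<Rightarrow> real" where
  "rate n s = (ln (real n) / real n) powr (s / (2 * s + 1))"


section \<open>Confidence bands\<close>

definition sample_algebra :: "nat \<Rightarrow> (nat \<Rightarrow> real) measure" where
  "sample_algebra n = Pi\<^sub>M {1..n} (\<lambda>_. restrict_space borel {0..1})"

text \<open>The joint law of \<open>X\<^sub>1, ..., X\<^sub>n\<close> i.i.d. with density \<open>f\<close> on \<open>[0,1]\<close>.\<close>

definition sample_law :: "nat \<Rightarrow> (real \<Rightarrow> real) \<Rightarrow> (nat \<Rightarrow> real) measure" where
  "sample_law n f =
     Pi\<^sub>M {1..n} (\<lambda>_. density (restrict_space lborel {0..1}) (\<lambda>x. ennreal (f x)))"

text \<open>
  A band is given by its end point functions: \<open>[lo n X y, hi n X y]\<close> is the interval at \<open>y\<close>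
  computed from the sample \<open>X\<close> of size \<open>n\<close>.
\<close>

type_synonym band_end = "nat \<Rightarrow> (nat \<Rightarrow> real) \<Rightarrow> real \<Rightarrow> real"

definition band_diam :: "band_end \<Rightarrow> band_end \<Rightarrow> nat \<Rightarrow> (nat \<Rightarrow> real) \<Rightarrow> ennreal" where
  "band_diam lo hi n X = (SUP y\<in>{0..1}. ennreal \<bar>hi n X y - lo n X y\<bar>)"

definition confidence_band :: "band_end \<Rightarrow> band_end \<Rightarrow> bool" where
  "confidence_band lo hi \<longleftrightarrow>
     (\<forall>n. (\<forall>y\<in>{0..1}. (\<lambda>X. lo n X y) \<in> borel_measurable (sample_algebra n) \<and>
                        (\<lambda>X. hi n X y) \<in> borel_measurable (sample_algebra n)) \<and>
          band_diam lo hi n \<in> borel_measurable (sample_algebra n))"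

text \<open>
  Non-measurable sets have \<open>measure\<close> zero, so for \<open>\<alpha> < 1\<close> asymptotic honesty includes that the
  coverage events of the densities in \<open>P n\<close> are measurable for all large \<open>n\<close>.
\<close>

definition coverage_prob :: "band_end \<Rightarrow> band_end \<Rightarrow> nat \<Rightarrow> (real \<Rightarrow> real) \<Rightarrow> real" where
  "coverage_prob lo hi n f =
     measure (sample_law n f)
       {X \<in> space (sample_law n f). \<forall>y\<in>{0..1}. f y \<in> {lo n X y..hi n X y}}"

definition expected_diam :: "band_end \<Rightarrow> band_end \<Rightarrow> nat \<Rightarrow> (real \<Rightarrow> real) \<Rightarrow> ennreal" where
  "expected_diam lo hi n f = (\<integral>\<^sup>+X. band_diam lo hi n X \<partial>sample_law n f)"

definition asymp_honest ::
    "band_end \<Rightarrow> band_end \<Rightarrow> real \<Rightarrow> (nat \<Rightarrow> (real \<Rightarrow> real) set) \<Rightarrow> bool" where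
  "asymp_honest lo hi \<alpha> P \<longleftrightarrow>
     liminf (\<lambda>n. INF f\<in>P n. ereal (coverage_prob lo hi n f)) \<ge> ereal (1 - \<alpha>)"

end

theory Submission
  imports Defs "HOL-Real_Asymp.Real_Asymp"
begin

text \<open>
  Let \<open>f\<^sub>0 = 1\<close> and \<open>f\<^sub>k = 1 + \<epsilon> 2\<^bsup>-l(s+1/2)\<^esup> \<psi>\<^bsub>lk\<^esub>\<close>, where \<open>\<psi>\<^bsub>lk\<^esub>\<close> runs through the interior wavelets of a
  level with \<open>2\<^sup>l\<close> of order \<open>(n / log n)\<^bsup>1/(2s+1)\<^esup>\<close>. Testing against \<open>\<psi>\<^bsub>lk\<^esub>\<close> shows that \<open>f\<^sub>k\<close> is at
  distance at least a constant times \<open>r\<^sub>n(s)\<close> from \<open>\<Sigma>(t)\<close> for \<open>t \<ge> s + \<zeta> / log n\<close>, because then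
  \<open>2\<^bsup>-l(t-s)\<^esup>\<close> is exponentially small in \<open>\<zeta>\<close>. Hence, if \<open>\<rho>\<^sub>n(s)\<close> is below that constant times
  \<open>r\<^sub>n(s)\<close>, the band is honest at \<open>f\<^sub>0\<close> and at all \<open>f\<^sub>k\<close>. Under \<open>f\<^sub>0\<close> its diameter is of order
  \<open>r\<^sub>n(s') \<le> e\<^bsup>-\<kappa>\<zeta>\<^esup> r\<^sub>n(s)\<close>, which for large \<open>\<zeta>\<close> is less than the distance of \<open>f\<^sub>0\<close> from every \<open>f\<^sub>k\<close>,
  so that the band separates \<open>f\<^sub>0\<close> from all \<open>f\<^sub>k\<close> simultaneously. This is impossible, since the
  chi-square distance between \<open>f\<^sub>0\<close> and the uniform mixture of the \<open>f\<^sub>k\<close> is at most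
  \<open>n powr (\<epsilon>\<^sup>2) * 2\<^bsup>-l\<^esup>\<close> up to a constant, and tends to zero for small \<open>\<epsilon>\<close>.
\<close>

section \<open>Mixtures of product measures\<close>

text \<open>Both measures agree on boxes, because the indicator of a box factorises and the integral
  of a product over a product measure splits. This gives the likelihood ratio of a sample law
  against the uniform one.\<close>

lemma PiM_density:
  assumes "finite I" and "prob_space \<mu>" and "prob_space (density \<mu> f)"
    and f [measurable]: "f \<in> borel_measurable \<mu>"
  shows "Pi\<^sub>M I (\<lambda>_. density \<mu> f) = density (Pi\<^sub>M I (\<lambda>_. \<mu>)) (\<lambda>x. \<Prod>i\<in>I. f (x i))"
proof -
  interpret M: prob_space \<mu> by fact
  interpret D: prob_space "density \<mu> f" by fact
  interpret PM: product_sigma_finite "\<lambda>_. \<mu>" by unfold_locales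
  interpret PD: product_sigma_finite "\<lambda>_. density \<mu> f" by unfold_locales
  have [simp]: "finite I" by fact
  have "density (Pi\<^sub>M I (\<lambda>_. \<mu>)) (\<lambda>x. \<Prod>i\<in>I. f (x i)) = Pi\<^sub>M I (\<lambda>_. density \<mu> f)"
  proof (rule PD.PiM_eqI)
    show "sets (density (Pi\<^sub>M I (\<lambda>_. \<mu>)) (\<lambda>x. \<Prod>i\<in>I. f (x i))) = sets (Pi\<^sub>M I (\<lambda>_. density \<mu> f))"
      by (simp cong: sets_PiM_cong)
  next
    fix A assume A: "\<And>i. i \<in> I \<Longrightarrow> A i \<in> sets (density \<mu> f)"
    then have [measurable]: "\<And>i. i \<in> I \<Longrightarrow> A i \<in> sets \<mu>" by simp
    have "emeasure (density (Pi\<^sub>M I (\<lambda>_. \<mu>)) (\<lambda>x. \<Prod>i\<in>I. f (x i))) (Pi\<^sub>E I A)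
        = (\<integral>\<^sup>+x. (\<Prod>i\<in>I. f (x i)) * indicator (Pi\<^sub>E I A) x \<partial>Pi\<^sub>M I (\<lambda>_. \<mu>))"
      by (subst emeasure_density) (auto intro!: sets_PiM_I_finite)
    also have "\<dots> = (\<integral>\<^sup>+x. (\<Prod>i\<in>I. f (x i) * indicator (A i) (x i)) \<partial>Pi\<^sub>M I (\<lambda>_. \<mu>))"
    proof (rule nn_integral_cong)
      fix x assume "x \<in> space (Pi\<^sub>M I (\<lambda>_. \<mu>))"
      then have "(indicator (Pi\<^sub>E I A) x :: ennreal) = (\<Prod>i\<in>I. indicator (A i) (x i))"
        by (auto simp: indicator_def space_PiM PiE_iff prod_zero_iff intro!: prod.neutral[symmetric])
      then show "(\<Prod>i\<in>I. f (x i)) * indicator (Pi\<^sub>E I A) x = (\<Prod>i\<in>I. f (x i) * indicator (A i) (x i))"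
        by (simp add: prod.distrib)
    qed
    also have "\<dots> = (\<Prod>i\<in>I. \<integral>\<^sup>+x. f x * indicator (A i) x \<partial>\<mu>)"
      by (rule PM.product_nn_integral_prod) auto
    also have "\<dots> = (\<Prod>i\<in>I. emeasure (density \<mu> f) (A i))"
      by (intro prod.cong refl) (simp add: emeasure_density)
    finally show "emeasure (density (Pi\<^sub>M I (\<lambda>_. \<mu>)) (\<lambda>x. \<Prod>i\<in>I. f (x i))) (Pi\<^sub>E I A)
        = (\<Prod>i\<in>I. emeasure (density \<mu> f) (A i))" .
  qed simp
  then show ?thesis ..
qed

text \<open>\<open>Z\<close> is the likelihood ratio of the uniform mixture minus one. Expanding its
  square leaves pairs of ratios, whose integrals split over the coordinates. By orthogonality the
  off-diagonal pairs of centred ratios integrate to zero, so only \<open>card K\<close> of the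
  \<open>card K ^ 2\<close> terms survive.\<close>

lemma chi_square_product_mixture:
  fixes h :: "'k \<Rightarrow> 'a \<Rightarrow> real"
  assumes "prob_space \<mu>" and I: "finite I" and K: "finite K" "K \<noteq> {}"
    and h [measurable]: "\<And>k. k \<in> K \<Longrightarrow> h k \<in> borel_measurable \<mu>"
    and bound: "\<And>k x. k \<in> K \<Longrightarrow> x \<in> space \<mu> \<Longrightarrow> \<bar>h k x\<bar> \<le> 1"
    and mean: "\<And>k. k \<in> K \<Longrightarrow> (\<integral>x. h k x \<partial>\<mu>) = 0"
    and orth: "\<And>k l. k \<in> K \<Longrightarrow> l \<in> K \<Longrightarrow> (\<integral>x. h k x * h l x \<partial>\<mu>) = (if k = l then v else 0)"
  defines "Z \<equiv> \<lambda>X. (\<Sum>k\<in>K. \<Prod>i\<in>I. 1 + h k (X i)) / card K - 1"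
  shows "integrable (Pi\<^sub>M I (\<lambda>_. \<mu>)) (\<lambda>X. (Z X)\<^sup>2)"
    and "(\<integral>X. (Z X)\<^sup>2 \<partial>Pi\<^sub>M I (\<lambda>_. \<mu>)) = ((1 + v) ^ card I - 1) / card K"
proof -
  interpret M: prob_space \<mu> by fact
  interpret PM: product_sigma_finite "\<lambda>_. \<mu>" by unfold_locales
  interpret P: prob_space "Pi\<^sub>M I (\<lambda>_. \<mu>)" by (rule prob_space_PiM) (rule assms(1))
  let ?P = "Pi\<^sub>M I (\<lambda>_. \<mu>)"
  define F where "F k X = (\<Prod>i\<in>I. 1 + h k (X i))" for k X
  have ih: "integrable \<mu> (h k)" if "k \<in> K" for k
    using that bound by (intro M.integrable_const_bound[where B = 1]) auto
  have ihh: "integrable \<mu> (\<lambda>x. h k x * h l x)" if "k \<in> K" "l \<in> K" for k l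
    using that bound
    by (intro M.integrable_const_bound[where B = "1 * 1"])
       (auto simp: abs_mult intro!: AE_I2 mult_le_one)
  have i2: "integrable \<mu> (\<lambda>x. (1 + h k x) * (1 + h l x))" if "k \<in> K" "l \<in> K" for k l
    unfolding distrib_left distrib_right using ih ihh that by auto
  have v2: "(\<integral>x. (1 + h k x) * (1 + h l x) \<partial>\<mu>) = 1 + (if k = l then v else 0)"
    if "k \<in> K" "l \<in> K" for k l
    unfolding distrib_left distrib_right using ih ihh that
    by (simp add: mean orth M.prob_space)
  have iF: "integrable ?P (F k)" "(\<integral>X. F k X \<partial>?P) = 1" if "k \<in> K" for k
    unfolding F_def using ih that PM.product_integral_prod[OF I, of "\<lambda>_ x. 1 + h k x"]
    by (auto intro!: PM.product_integrable_prod simp: I mean M.prob_space)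
  have FF: "F k X * F l X = (\<Prod>i\<in>I. (1 + h k (X i)) * (1 + h l (X i)))" for k l X
    by (simp add: F_def prod.distrib)
  have iFF: "integrable ?P (\<lambda>X. F k X * F l X)"
    "(\<integral>X. F k X * F l X \<partial>?P) = (1 + (if k = l then v else 0)) ^ card I" if "k \<in> K" "l \<in> K" for k l
    unfolding FF using i2 that
      PM.product_integral_prod[OF I, of "\<lambda>_ x. (1 + h k x) * (1 + h l x)"]
    by (auto intro!: PM.product_integrable_prod simp: I v2)
  have c: "real (card K) > 0" using K by (simp add: card_gt_0_iff)
  \<comment> \<open>Moving the \<open>1\<close> inside the average writes \<open>Z\<close> as a mean
    of centred ratios \<open>F k - 1\<close>, whose mixed moments vanish for distinct
    indices.\<close>
  have Zeq: "(Z X)\<^sup>2 = (\<Sum>k\<in>K. \<Sum>l\<in>K. (F k X - 1) * (F l X - 1)) / (real (card K))\<^sup>2" for X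
  proof -
    have "Z X = (\<Sum>k\<in>K. F k X - 1) / card K"
      using c by (simp add: Z_def F_def sum_subtractf diff_divide_distrib)
    then show ?thesis
      by (simp add: power2_eq_square sum_product)
  qed
  have iG: "integrable ?P (\<lambda>X. (F k X - 1) * (F l X - 1))"
    "(\<integral>X. (F k X - 1) * (F l X - 1) \<partial>?P) = (if k = l then (1 + v) ^ card I - 1 else 0)"
    if "k \<in> K" "l \<in> K" for k l
    unfolding left_diff_distrib right_diff_distrib using iF iFF that
    by (auto simp: P.prob_space)
  show "integrable ?P (\<lambda>X. (Z X)\<^sup>2)"
    unfolding Zeq using iG by auto
  have "(\<integral>X. (Z X)\<^sup>2 \<partial>?P) = (\<Sum>k\<in>K. \<Sum>l\<in>K. \<integral>X. (F k X - 1) * (F l X - 1) \<partial>?P) / (real (card K))\<^sup>2"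
    unfolding Zeq using iG by (simp add: integral_sum)
  also have "\<dots> = (\<Sum>k\<in>K. \<Sum>l\<in>K. if k = l then (1 + v) ^ card I - 1 else 0) / (real (card K))\<^sup>2"
    using iG by (simp cong: sum.cong)
  also have "\<dots> = ((1 + v) ^ card I - 1) / card K"
    using K c by (simp add: power2_eq_square)
  finally show "(\<integral>X. (Z X)\<^sup>2 \<partial>?P) = ((1 + v) ^ card I - 1) / card K" .
qed

text \<open>The base probability of \<open>A\<close> minus its average probability under the
  alternatives is the integral of \<open>- Z\<close> over \<open>A\<close>, which the second moment
  of \<open>Z\<close> controls. So an event that is unlikely under all alternatives is unlikely
  under the base law.\<close>

lemma product_mixture_testing_bound:
  fixes h :: "'k \<Rightarrow> 'a \<Rightarrow> real"
  assumes "prob_space \<mu>" and I: "finite I" and K: "finite K" "K \<noteq> {}"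
    and h [measurable]: "\<And>k. k \<in> K \<Longrightarrow> h k \<in> borel_measurable \<mu>"
    and bound: "\<And>k x. k \<in> K \<Longrightarrow> x \<in> space \<mu> \<Longrightarrow> \<bar>h k x\<bar> \<le> 1"
    and mean: "\<And>k. k \<in> K \<Longrightarrow> (\<integral>x. h k x \<partial>\<mu>) = 0"
    and orth: "\<And>k l. k \<in> K \<Longrightarrow> l \<in> K \<Longrightarrow> (\<integral>x. h k x * h l x \<partial>\<mu>) = (if k = l then v else 0)"
    and \<eta>: "0 < \<eta>" "((1 + v) ^ card I - 1) / card K \<le> \<eta>\<^sup>2"
    and A [measurable]: "A \<in> sets (Pi\<^sub>M I (\<lambda>_. \<mu>))"
    and b: "\<And>k. k \<in> K \<Longrightarrow> measure (Pi\<^sub>M I (\<lambda>_. density \<mu> (\<lambda>x. ennreal (1 + h k x)))) A \<le> b"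
  shows "measure (Pi\<^sub>M I (\<lambda>_. \<mu>)) A \<le> b + \<eta>"
proof -
  interpret M: prob_space \<mu> by fact
  interpret PM: product_sigma_finite "\<lambda>_. \<mu>" by unfold_locales
  interpret P: prob_space "Pi\<^sub>M I (\<lambda>_. \<mu>)" by (rule prob_space_PiM) (rule assms(1))
  let ?P = "Pi\<^sub>M I (\<lambda>_. \<mu>)"
  define F where "F k X = (\<Prod>i\<in>I. 1 + h k (X i))" for k X
  define Z where "Z X = (\<Sum>k\<in>K. F k X) / card K - 1" for X
  have ih: "integrable \<mu> (h k)" if "k \<in> K" for k
    using that bound by (intro M.integrable_const_bound[where B = 1]) auto
  have nonneg: "0 \<le> 1 + h k x" if "k \<in> K" "x \<in> space \<mu>" for k x
    using bound[OF that] by linarith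
  have iF: "integrable ?P (F k)" "(\<integral>X. F k X \<partial>?P) = 1" if "k \<in> K" for k
    unfolding F_def using ih that PM.product_integral_prod[OF I, of "\<lambda>_ x. 1 + h k x"]
    by (auto intro!: PM.product_integrable_prod simp: I mean M.prob_space)
  have F0: "0 \<le> F k X" if "k \<in> K" "X \<in> space ?P" for k X
    unfolding F_def using that by (intro prod_nonneg) (auto intro!: nonneg simp: space_PiM PiE_iff)
  have iFA: "integrable ?P (\<lambda>X. F k X * indicator A X)" if "k \<in> K" for k
    using integrable_mult_indicator[OF A iF(1)[OF that]] by (simp add: mult.commute)
  \<comment> \<open>Change of measure: boundedness of \<open>h\<close> makes \<open>1 + h k\<close>
    nonnegative, and zero mean makes it a probability density.\<close>
  have meas: "measure (Pi\<^sub>M I (\<lambda>_. density \<mu> (\<lambda>x. ennreal (1 + h k x)))) A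
      = (\<integral>X. F k X * indicator A X \<partial>?P)" if k: "k \<in> K" for k
  proof -
    have [measurable]: "h k \<in> borel_measurable \<mu>" using k by simp
    have D: "prob_space (density \<mu> (\<lambda>x. ennreal (1 + h k x)))"
    proof (rule prob_spaceI)
      have "(\<integral>\<^sup>+x. ennreal (1 + h k x) \<partial>\<mu>) = ennreal (\<integral>x. 1 + h k x \<partial>\<mu>)"
        using ih[OF k] nonneg[OF k] by (intro nn_integral_eq_integral) auto
      also have "\<dots> = 1" using ih[OF k] by (simp add: mean k M.prob_space)
      finally show "emeasure (density \<mu> (\<lambda>x. ennreal (1 + h k x)))
          (space (density \<mu> (\<lambda>x. ennreal (1 + h k x)))) = 1"
        by (simp add: emeasure_density cong: nn_integral_cong_simp)
    qed
    have "emeasure (Pi\<^sub>M I (\<lambda>_. density \<mu> (\<lambda>x. ennreal (1 + h k x)))) A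
        = (\<integral>\<^sup>+X. (\<Prod>i\<in>I. ennreal (1 + h k (X i))) * indicator A X \<partial>?P)"
      by (subst PiM_density[OF I assms(1) D]) (auto simp: emeasure_density)
    also have "\<dots> = (\<integral>\<^sup>+X. ennreal (F k X * indicator A X) \<partial>?P)"
    proof (rule nn_integral_cong)
      fix X assume "X \<in> space ?P"
      then have "(\<Prod>i\<in>I. ennreal (1 + h k (X i))) = ennreal (F k X)"
        unfolding F_def by (subst prod_ennreal) (auto intro!: nonneg k simp: space_PiM PiE_iff)
      then show "(\<Prod>i\<in>I. ennreal (1 + h k (X i))) * indicator A X = ennreal (F k X * indicator A X)"
        by (simp add: indicator_def)
    qed
    also have "\<dots> = ennreal (\<integral>X. F k X * indicator A X \<partial>?P)"
      using iFA[OF k] F0[OF k] by (intro nn_integral_eq_integral) (auto intro!: AE_I2)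
    finally show ?thesis
      using F0[OF k] by (auto simp: measure_def intro!: enn2real_ennreal Bochner_Integration.integral_nonneg)
  qed
  have c: "real (card K) > 0" using K by (simp add: card_gt_0_iff)
  note chi = chi_square_product_mixture[OF assms(1) I K h bound mean orth, folded F_def, folded Z_def]
  have iZ: "integrable ?P Z"
    unfolding Z_def using iF by auto
  have iZA: "integrable ?P (\<lambda>X. Z X * indicator A X)"
    using integrable_mult_indicator[OF A iZ] by (simp add: mult.commute)
  have "measure ?P A - (\<Sum>k\<in>K. \<integral>X. F k X * indicator A X \<partial>?P) / card K
      = (\<integral>X. - (Z X * indicator A X) \<partial>?P)"
  proof -
    have *: "Z X * indicator A X = (\<Sum>k\<in>K. F k X * indicator A X) / card K - indicator A X" for X
      unfolding Z_def left_diff_distrib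
      by (simp add: sum_distrib_right[symmetric])
    show ?thesis
      unfolding * Bochner_Integration.integral_minus
      by (subst Bochner_Integration.integral_diff) (use iFA in \<open>auto simp: integral_sum P.emeasure_eq_measure\<close>)
  qed
  also have "\<dots> \<le> (\<integral>X. \<eta> / 2 + (Z X)\<^sup>2 / (2 * \<eta>) \<partial>?P)"
  proof (rule integral_mono)
    fix X
    \<comment> \<open>AM-GM replaces the Cauchy--Schwarz inequality\<close>
    have "0 \<le> (\<eta> + Z X * indicator A X)\<^sup>2" by simp
    then have "- (Z X * indicator A X) * (2 * \<eta>) \<le> \<eta>\<^sup>2 + (Z X * indicator A X)\<^sup>2"
      by (simp add: power2_eq_square algebra_simps)
    also have "\<dots> \<le> \<eta>\<^sup>2 + (Z X)\<^sup>2" by (auto simp: indicator_def)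
    also have "\<dots> = (\<eta> / 2 + (Z X)\<^sup>2 / (2 * \<eta>)) * (2 * \<eta>)"
      using \<eta>(1) by (simp add: field_simps power2_eq_square)
    finally show "- (Z X * indicator A X) \<le> \<eta> / 2 + (Z X)\<^sup>2 / (2 * \<eta>)"
      using \<eta>(1) by (simp only: mult_le_cancel_right)
  qed (use iZA chi(1) in auto)
  also have "\<dots> = \<eta> / 2 + ((1 + v) ^ card I - 1) / card K / (2 * \<eta>)"
    using chi by (simp add: P.prob_space)
  also have "\<dots> \<le> \<eta> / 2 + \<eta>\<^sup>2 / (2 * \<eta>)"
    using \<eta> by (intro add_left_mono divide_right_mono) auto
  also have "\<dots> = \<eta>" using \<eta>(1) by (simp add: power2_eq_square)
  finally have 1: "measure ?P A \<le> (\<Sum>k\<in>K. \<integral>X. F k X * indicator A X \<partial>?P) / card K + \<eta>"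
    by simp
  have "(\<Sum>k\<in>K. \<integral>X. F k X * indicator A X \<partial>?P) \<le> (\<Sum>k\<in>K. b)"
    using b meas by (intro sum_mono) auto
  then have "(\<Sum>k\<in>K. \<integral>X. F k X * indicator A X \<partial>?P) / card K \<le> b"
    using c by (simp add: field_simps)
  with 1 show ?thesis by linarith
qed

section \<open>Interior wavelets and perturbations of the uniform density\<close>

text \<open>The pointwise bound \<open>\<bar>f x\<bar> \<le> 1 + (f x)^2\<close> suffices, since
  constants are integrable on a bounded interval.\<close>

lemma set_integrable_square_integrable:
  assumes "square_integrable_on {a..b} f"
  shows "set_integrable lborel {a..b} f"
proof -
  have "set_integrable lborel {a..b} (\<lambda>x. 1 + (f x)\<^sup>2)"
    using assms by (intro set_integral_add) (auto simp: square_integrable_on_def intro: borel_integrable_atLeastAtMost')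
  moreover have "\<bar>f x\<bar> \<le> 1 + (f x)\<^sup>2" for x
  proof -
    have "2 * 1 * \<bar>f x\<bar> \<le> 1\<^sup>2 + \<bar>f x\<bar>\<^sup>2" by (rule sum_squares_bound)
    then show ?thesis by simp
  qed
  ultimately show ?thesis
    using assms by (elim set_integrable_bound) (auto simp: square_integrable_on_def)
qed

lemma set_integrable_mult_square_integrable:
  assumes "square_integrable_on A f" "square_integrable_on A g"
  shows "set_integrable lborel A (\<lambda>x. f x * g x)"
proof -
  have "set_integrable lborel A (\<lambda>x. (f x)\<^sup>2 + (g x)\<^sup>2)"
    using assms by (intro set_integral_add) (auto simp: square_integrable_on_def)
  moreover have "\<bar>f x * g x\<bar> \<le> (f x)\<^sup>2 + (g x)\<^sup>2" for x
  proof -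
    have "2 * \<bar>f x\<bar> * \<bar>g x\<bar> \<le> \<bar>f x\<bar>\<^sup>2 + \<bar>g x\<bar>\<^sup>2" by (rule sum_squares_bound)
    moreover have "0 \<le> \<bar>f x\<bar> * \<bar>g x\<bar>" by simp
    ultimately show ?thesis unfolding abs_mult power2_abs by linarith
  qed
  moreover have "set_borel_measurable lborel A (\<lambda>x. f x * g x)"
  proof -
    have [measurable]: "(\<lambda>x. indicator A x *\<^sub>R f x) \<in> borel_measurable lborel"
      "(\<lambda>x. indicator A x *\<^sub>R g x) \<in> borel_measurable lborel"
      using assms by (auto simp: square_integrable_on_def set_borel_measurable_def)
    have "(\<lambda>x. (indicator A x *\<^sub>R f x) * (indicator A x *\<^sub>R g x)) \<in> borel_measurable lborel"
      by measurable
    moreover have "(\<lambda>x. (indicator A x *\<^sub>R f x) * (indicator A x *\<^sub>R g x)) = (\<lambda>x. indicator A x *\<^sub>R (f x * g x))"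
      by (auto simp: indicator_def)
    ultimately show ?thesis by (simp add: set_borel_measurable_def)
  qed
  ultimately show ?thesis
    by (elim set_integrable_bound) auto
qed

text \<open>These are the positions where \<open>level_fun\<close> uses plain translates of the
  mother wavelet, whose supports lie inside the unit interval.\<close>

definition interior_indices :: "wavelet_system \<Rightarrow> nat \<Rightarrow> nat set" where
  "interior_indices W l = {vmoments W<..2 ^ l - vmoments W}"

definition perturbed_uniform :: "wavelet_system \<Rightarrow> nat \<Rightarrow> real \<Rightarrow> nat \<Rightarrow> real \<Rightarrow> real" where
  "perturbed_uniform W l c k = (\<lambda>x. 1 + c * wavelet_fun W l k x)"

lemma wavelet_fun_interior:
  assumes "k \<in> interior_indices W l"
  shows "wavelet_fun W l k x = 2 powr (real l / 2) * mother W (2 ^ l * x - (real k - 1))"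
  using assms by (auto simp: wavelet_fun_def level_fun_def interior_indices_def)

section \<open>Facts read off from the wavelet system\<close>

context
  fixes S :: nat and W :: wavelet_system
  assumes wavelets: "boundary_corrected_daubechies S W"
begin

lemma vmoments_pos: "1 \<le> vmoments W"
  and vmoments_le: "2 * vmoments W \<le> 2 ^ coarse W"
  and continuous_mother: "continuous_on UNIV (mother W)"
  and wavelet_basis: "L2_orthonormal_basis {0..1} (wavelet_indices (coarse W)) (wavelet_family W (coarse W))"
  using wavelets by (auto simp: boundary_corrected_daubechies_def Let_def C_k_on_def)

text \<open>This is the vanishing moment of order 0, available because
  \<open>1 \<le> vmoments W\<close>. It allows adding a wavelet to a density without changing the
  total mass.\<close>

lemma wavelet_mean_zero:
  assumes "coarse W \<le> l" "k \<in> {1..2 ^ l}"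
  shows "(LBINT x:{0..1}. wavelet_fun W l k x) = 0"
proof -
  have "\<forall>j<vmoments W. (LBINT x:{0..1}. x ^ j * wavelet_fun W l k x) = 0"
    using wavelets assms by (auto simp: boundary_corrected_daubechies_def Let_def)
  with vmoments_pos show ?thesis by (force dest: spec[of _ 0])
qed

text \<open>The support is inherited through the refinement equation: if \<open>2 * x - n\<close>
  and \<open>n\<close> both lie in \<open>[1 - M, M]\<close>, then so does \<open>x\<close>.\<close>

lemma mother_support:
  assumes "x \<notin> {1 - real (vmoments W)..real (vmoments W)}"
  shows "mother W x = 0"
proof -
  let ?M = "vmoments W"
  have pair: "daubechies_pair ?M (filt W) (father W) (mother W)"
    using wavelets by (auto simp: boundary_corrected_daubechies_def Let_def)
  have father_support: "father W y = 0" if "y \<notin> {1 - real ?M..real ?M}" for y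
    using pair that unfolding daubechies_pair_def by blast
  have refine: "mother W x = sqrt 2 *
      (\<Sum>n=1 - int ?M..int ?M. (- 1) powi n * filt W (1 - n) * father W (2 * x - of_int n))"
    using pair unfolding daubechies_pair_def by blast
  have "father W (2 * x - of_int n) = 0" if "n \<in> {1 - int ?M..int ?M}" for n
  proof -
    have "1 - real ?M \<le> of_int n" "of_int n \<le> real ?M" using that by auto
    then have "2 * x - of_int n \<notin> {1 - real ?M..real ?M}" using assms by auto
    then show ?thesis by (rule father_support)
  qed
  then show ?thesis unfolding refine by simp
qed

lemma mother_bounded: "\<exists>C>0. \<forall>x. \<bar>mother W x\<bar> \<le> C"
proof -
  let ?I = "{1 - real (vmoments W)..real (vmoments W)}"
  have "compact (mother W ` ?I)"
    by (intro compact_continuous_image continuous_on_subset[OF continuous_mother]) auto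
  then obtain C where C: "C > 0" "\<forall>x\<in>?I. \<bar>mother W x\<bar> \<le> C"
    by (auto dest!: compact_imp_bounded simp: bounded_pos)
  have "\<bar>mother W x\<bar> \<le> C" for x
    using C mother_support[of x] by (cases "x \<in> ?I") auto
  with C show ?thesis by blast
qed

lemma interior_indices_subset: "interior_indices W l \<subseteq> {1..2 ^ l}"
  by (auto simp: interior_indices_def)

lemma finite_interior_indices: "finite (interior_indices W l)"
  by (simp add: interior_indices_def)

text \<open>A level strictly above the coarsest one doubles \<open>2 * M \<le> 2 ^ coarse W\<close>
  to \<open>4 * M \<le> 2 ^ l\<close>, so the \<open>2 * M\<close> edge positions are at most half
  of all.\<close>

lemma card_interior_indices:
  assumes "coarse W < l"
  shows "2 ^ l \<le> 2 * real (card (interior_indices W l))"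
proof -
  have "2 * (2 * vmoments W) \<le> 2 * 2 ^ coarse W" using vmoments_le by simp
  also have "\<dots> = 2 ^ Suc (coarse W)" by simp
  also have "\<dots> \<le> 2 ^ l" using assms by (intro power_increasing) auto
  finally have "2 * (2 * vmoments W) \<le> 2 ^ l" .
  then have "2 ^ l \<le> 2 * card (interior_indices W l)" by (simp add: interior_indices_def)
  then show ?thesis by (metis of_nat_le_iff of_nat_mult of_nat_numeral of_nat_power)
qed

lemma interior_indices_nonempty:
  assumes "coarse W < l"
  shows "interior_indices W l \<noteq> {}"
proof
  assume "interior_indices W l = {}"
  then have "(2 :: real) ^ l \<le> 0" using card_interior_indices[OF assms] by simp
  moreover have "(0 :: real) < 2 ^ l" by simp
  ultimately show False by linarith
qed

lemma wavelet_orthonormal: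
  assumes "coarse W \<le> l" "k \<in> {1..2 ^ l}" "coarse W \<le> l'" "k' \<in> {1..2 ^ l'}"
  shows "(LBINT x:{0..1}. wavelet_fun W l k x * wavelet_fun W l' k' x)
    = (if l = l' \<and> k = k' then 1 else 0)"
proof -
  have "Inr (l, k) \<in> wavelet_indices (coarse W)" "Inr (l', k') \<in> wavelet_indices (coarse W)"
    using assms by (auto simp: wavelet_indices_def)
  then have "(LBINT x:{0..1}. wavelet_family W (coarse W) (Inr (l, k)) x * wavelet_family W (coarse W) (Inr (l', k')) x)
      = (if Inr (l, k) = (Inr (l', k') :: nat + nat \<times> nat) then 1 else 0)"
    using wavelet_basis unfolding L2_orthonormal_basis_def by blast
  then show ?thesis by (simp add: wavelet_family_def)
qed

lemma wavelet_scaling_orthogonal: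
  assumes "coarse W \<le> l" "k \<in> {1..2 ^ l}" "i \<in> {1..2 ^ coarse W}"
  shows "(LBINT x:{0..1}. wavelet_fun W l k x * scaling_fun W (coarse W) i x) = 0"
proof -
  have "Inr (l, k) \<in> wavelet_indices (coarse W)" "Inl i \<in> wavelet_indices (coarse W)"
    using assms by (auto simp: wavelet_indices_def)
  then have "(LBINT x:{0..1}. wavelet_family W (coarse W) (Inr (l, k)) x * wavelet_family W (coarse W) (Inl i) x)
      = (if Inr (l, k) = (Inl i :: nat + nat \<times> nat) then 1 else 0)"
    using wavelet_basis unfolding L2_orthonormal_basis_def by blast
  then show ?thesis by (simp add: wavelet_family_def)
qed

lemma scaling_normalized:
  assumes "i \<in> {1..2 ^ coarse W}"
  shows "(LBINT x:{0..1}. scaling_fun W (coarse W) i x * scaling_fun W (coarse W) i x) = 1"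
proof -
  have "Inl i \<in> wavelet_indices (coarse W)" using assms by (auto simp: wavelet_indices_def)
  then have "(LBINT x:{0..1}. wavelet_family W (coarse W) (Inl i) x * wavelet_family W (coarse W) (Inl i) x)
      = (if Inl i = (Inl i :: nat + nat \<times> nat) then 1 else 0)"
    using wavelet_basis unfolding L2_orthonormal_basis_def by blast
  then show ?thesis by (simp add: wavelet_family_def)
qed

lemma wavelet_square_integrable:
  assumes "coarse W \<le> l" "k \<in> {1..2 ^ l}"
  shows "square_integrable_on {0..1} (wavelet_fun W l k)"
proof -
  have "Inr (l, k) \<in> wavelet_indices (coarse W)"
    using assms by (auto simp: wavelet_indices_def)
  then have "square_integrable_on {0..1} (wavelet_family W (coarse W) (Inr (l, k)))"
    using wavelet_basis unfolding L2_orthonormal_basis_def by blast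
  then show ?thesis by (simp add: wavelet_family_def)
qed

lemma scaling_square_integrable:
  assumes "i \<in> {1..2 ^ coarse W}"
  shows "square_integrable_on {0..1} (scaling_fun W (coarse W) i)"
proof -
  have "Inl i \<in> wavelet_indices (coarse W)"
    using assms by (auto simp: wavelet_indices_def)
  then have "square_integrable_on {0..1} (wavelet_family W (coarse W) (Inl i))"
    using wavelet_basis unfolding L2_orthonormal_basis_def by blast
  then show ?thesis by (simp add: wavelet_family_def)
qed

text \<open>Cauchy-Schwarz against the constant 1, in the pointwise form
  \<open>\<bar>x\<bar> \<le> (1 + x^2) / 2\<close>. It bounds the scaling coefficients of the
  uniform density by 1, hence by \<open>B\<close>.\<close>

lemma scaling_integral_le_1:
  assumes "i \<in> {1..2 ^ coarse W}"
  shows "\<bar>LBINT x:{0..1}. scaling_fun W (coarse W) i x\<bar> \<le> 1"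
proof -
  let ?\<phi> = "scaling_fun W (coarse W) i"
  note sq = scaling_square_integrable[OF assms]
  have int: "set_integrable lborel {0..1} ?\<phi>" by (rule set_integrable_square_integrable[OF sq])
  have int2: "set_integrable lborel {0..1} (\<lambda>x. ?\<phi> x * ?\<phi> x)"
    by (rule set_integrable_mult_square_integrable[OF sq sq])
  have one: "set_integrable lborel {0..1} (\<lambda>x::real. 1 :: real)" by (rule borel_integrable_atLeastAtMost') simp
  have intb: "set_integrable lborel {0..1} (\<lambda>x. (1 + ?\<phi> x * ?\<phi> x) * (1 / 2))"
    by (rule set_integrable_mult_left) (rule set_integral_add(1)[OF one int2])
  have "\<bar>LBINT x:{0..1}. ?\<phi> x\<bar> \<le> (LBINT x:{0..1}. \<bar>?\<phi> x\<bar>)"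
    using set_integral_norm_bound[OF int] by simp
  also have "\<dots> \<le> (LBINT x:{0..1}. (1 + ?\<phi> x * ?\<phi> x) * (1 / 2))"
  proof (rule set_integral_mono[OF set_integrable_abs[OF int] intb])
    fix x
    have "0 \<le> (1 - \<bar>?\<phi> x\<bar>)\<^sup>2" by simp
    then show "\<bar>?\<phi> x\<bar> \<le> (1 + ?\<phi> x * ?\<phi> x) * (1 / 2)"
      by (simp add: power2_eq_square algebra_simps)
  qed
  also have "\<dots> = 1"
    using int2 one scaling_normalized[OF assms]
    by (simp add: set_integral_add set_lebesgue_integral_def[of _ _ "\<lambda>_. 1"])
  finally show ?thesis .
qed

section \<open>Size and location of interior wavelets\<close>

lemma continuous_wavelet_interior:
  assumes "k \<in> interior_indices W l"
  shows "continuous_on A (wavelet_fun W l k)"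
proof -
  have "wavelet_fun W l k = (\<lambda>x. 2 powr (real l / 2) * mother W (2 ^ l * x - (real k - 1)))"
    using wavelet_fun_interior[OF assms] by auto
  moreover have "continuous_on A (\<lambda>x. 2 powr (real l / 2) * mother W (2 ^ l * x - (real k - 1)))"
    by (intro continuous_intros continuous_on_compose2[OF continuous_mother]) auto
  ultimately show ?thesis by simp
qed

lemma wavelet_interior_bound:
  assumes "k \<in> interior_indices W l" "\<And>x. \<bar>mother W x\<bar> \<le> C"
  shows "\<bar>wavelet_fun W l k x\<bar> \<le> 2 powr (real l / 2) * C"
  using assms by (simp add: wavelet_fun_interior abs_mult)

text \<open>The height is of order \<open>2 powr (l / 2)\<close> and the support has length
  \<open>(2 * M - 1) / 2 ^ l\<close>. This \<open>L^1\<close> bound supplies the constant in the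
  duality argument for separation.\<close>

lemma wavelet_interior_abs_integral:
  assumes k: "k \<in> interior_indices W l" and C: "\<And>x. \<bar>mother W x\<bar> \<le> C"
  shows "(LBINT x:{0..1}. \<bar>wavelet_fun W l k x\<bar>) \<le> 2 * real (vmoments W) * C * 2 powr (- real l / 2)"
proof -
  let ?M = "real (vmoments W)"
  \<comment> \<open>The map \<open>x \<mapsto> 2 ^ l * x - (k - 1)\<close> carries
    \<open>[a, b]\<close> onto the support \<open>[1 - M, M]\<close> of the mother wavelet.\<close>
  define a b where "a = (real k - ?M) / 2 ^ l" and "b = (real k - 1 + ?M) / 2 ^ l"
  have ab: "a \<le> b" using vmoments_pos by (auto simp: a_def b_def divide_right_mono)
  have C0: "0 \<le> C" using C[of 0] by linarith
  have pw: "2 powr (real l / 2) / 2 ^ l = 2 powr (- real l / 2)"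
    by (simp add: powr_realpow[symmetric] powr_diff[symmetric])
  have "(LBINT x:{0..1}. \<bar>wavelet_fun W l k x\<bar>) = (LBINT x. indicator {0..1} x * \<bar>wavelet_fun W l k x\<bar>)"
    by (simp add: set_lebesgue_integral_def)
  also have "\<dots> \<le> (LBINT x. 2 powr (real l / 2) * C * indicator {a..b} x)"
  proof (rule integral_mono_AE')
    show "integrable lborel (\<lambda>x. 2 powr (real l / 2) * C * indicat_real {a..b} x)"
      by (intro integrable_mult_right integrable_real_indicator) (auto simp: emeasure_lborel_Icc_eq)
    show "AE x in lborel. indicator {0..1} x * \<bar>wavelet_fun W l k x\<bar>
        \<le> 2 powr (real l / 2) * C * indicator {a..b} x"
    proof (rule AE_I2)
      fix x :: real
      show "indicator {0..1} x * \<bar>wavelet_fun W l k x\<bar> \<le> 2 powr (real l / 2) * C * indicator {a..b} x"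
      proof (cases "x \<in> {a..b}")
        case True
        then show ?thesis using wavelet_interior_bound[OF k C, of x] C0 by (auto simp: indicator_def)
      next
        case False
        then have "2 ^ l * x - (real k - 1) \<notin> {1 - ?M..?M}"
          by (auto simp: a_def b_def field_simps)
        then show ?thesis
          using False by (simp add: wavelet_fun_interior[OF k] mother_support)
      qed
    qed
  qed (auto simp: C0)
  also have "\<dots> = 2 powr (real l / 2) * C * (b - a)" using ab by simp
  also have "b - a = (2 * ?M - 1) / 2 ^ l" by (simp add: a_def b_def diff_divide_distrib[symmetric])
  also have "2 powr (real l / 2) * C * ((2 * ?M - 1) / 2 ^ l) = (2 * ?M - 1) * C * (2 powr (real l / 2) / 2 ^ l)"
    by simp
  also have "\<dots> \<le> 2 * ?M * C * 2 powr (- real l / 2)"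
    unfolding pw using C0 by (intro mult_right_mono) auto
  finally show ?thesis .
qed

text \<open>A vanishing mother wavelet would contradict the unit norm of an interior
  wavelet.\<close>

lemma mother_nonzero: "\<exists>x. mother W x \<noteq> 0"
proof (rule ccontr)
  assume "\<nexists>x. mother W x \<noteq> 0"
  let ?l = "Suc (coarse W)"
  obtain k where k: "k \<in> interior_indices W ?l" using interior_indices_nonempty[OF lessI] by blast
  then have "(LBINT x:{0..1}. wavelet_fun W ?l k x * wavelet_fun W ?l k x) = 1"
    using interior_indices_subset[of ?l] by (subst wavelet_orthonormal) auto
  moreover have "wavelet_fun W ?l k x = 0" for x
    using \<open>\<nexists>x. mother W x \<noteq> 0\<close> by (simp add: wavelet_fun_interior[OF k])
  ultimately show False by simp
qed

text \<open>An affine change of variable carries a point of the mother support into the unit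
  interval. Hence all perturbations of one level reach a common height.\<close>

lemma wavelet_interior_peak:
  assumes k: "k \<in> interior_indices W l" and x: "mother W x \<noteq> 0"
  shows "\<exists>y\<in>{0..1}. wavelet_fun W l k y = 2 powr (real l / 2) * mother W x"
proof
  let ?y = "(x + (real k - 1)) / 2 ^ l"
  have x': "x \<in> {1 - real (vmoments W)..real (vmoments W)}" using x mother_support by blast
  show "wavelet_fun W l k ?y = 2 powr (real l / 2) * mother W x"
    by (simp add: wavelet_fun_interior[OF k])
  have "vmoments W < k" "k + vmoments W \<le> 2 ^ l" using k by (auto simp: interior_indices_def)
  moreover from this(2) have "real k + real (vmoments W) \<le> 2 ^ l"
    by (metis of_nat_add of_nat_le_iff of_nat_numeral of_nat_power)
  ultimately show "?y \<in> {0..1}" using x' by (auto simp: field_simps)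
qed

section \<open>Perturbed densities: membership in the Hoelder ball and separation\<close>

text \<open>By orthonormality the perturbation changes a single coefficient, the one at
  \<open>(l, k)\<close>, from 0 to \<open>c\<close>; the others are those of the uniform density.
  The second condition on \<open>c\<close> bounds this coefficient, the third keeps the function
  nonnegative.\<close>

lemma perturbed_uniform_holder:
  assumes k: "k \<in> interior_indices W l" and l: "coarse W \<le> l"
    and C: "\<And>x. \<bar>mother W x\<bar> \<le> C"
    and c: "0 \<le> c" "2 powr (real l * (s + 1 / 2)) * c \<le> B" "c * (2 powr (real l / 2) * C) \<le> 1"
    and B: "1 \<le> B"
  shows "perturbed_uniform W l c k \<in> holder_densities W B s"
proof -
  let ?f = "perturbed_uniform W l c k" and ?\<psi> = "wavelet_fun W l k"
  have k1: "k \<in> {1..2 ^ l}" using subsetD[OF interior_indices_subset k] .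
  note sq = wavelet_square_integrable[OF l k1]
  have int: "set_integrable lborel {0..1} ?\<psi>" by (rule set_integrable_square_integrable[OF sq])
  have one: "set_integrable lborel {0..1} (\<lambda>x::real. 1 :: real)" by (rule borel_integrable_atLeastAtMost') simp
  \<comment> \<open>Every coefficient in the norm is an instance with \<open>g\<close> a basis
    function, split into a uniform part and a wavelet part.\<close>
  have pair: "(LBINT x:{0..1}. ?f x * g x) = (LBINT x:{0..1}. g x) + c * (LBINT x:{0..1}. ?\<psi> x * g x)"
    if g: "square_integrable_on {0..1} g" for g
  proof -
    have "(LBINT x:{0..1}. ?f x * g x) = (LBINT x:{0..1}. g x + c * (?\<psi> x * g x))"
      by (simp add: perturbed_uniform_def algebra_simps)
    then show ?thesis
      using set_integrable_square_integrable[OF g] set_integrable_mult_square_integrable[OF sq g]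
      by (simp add: set_integral_add)
  qed
  have "0 \<le> ?f x" for x
  proof -
    have "\<bar>c * ?\<psi> x\<bar> \<le> c * (2 powr (real l / 2) * C)"
      unfolding abs_mult using c wavelet_interior_bound[OF k C, of x] by (auto intro!: mult_left_mono)
    then show ?thesis unfolding perturbed_uniform_def using c(3) by linarith
  qed
  moreover have "continuous_on {0..1} ?f"
    unfolding perturbed_uniform_def by (intro continuous_intros continuous_wavelet_interior k)
  moreover have "(LBINT x:{0..1}. ?f x) = 1"
    unfolding perturbed_uniform_def using int one wavelet_mean_zero[OF l k1]
    by (simp add: set_integral_add set_lebesgue_integral_def[of _ _ "\<lambda>_. 1"])
  moreover have "holder_norm W s ?f \<le> ennreal B"
  proof -
    have "\<bar>alpha_coeff W ?f i\<bar> \<le> B" if "i \<in> {1..2 ^ coarse W}" for i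
      using pair[OF scaling_square_integrable[OF that]] scaling_integral_le_1[OF that]
        wavelet_scaling_orthogonal[OF l k1 that] B
      by (simp add: alpha_coeff_def)
    moreover have "2 powr (real l' * (s + 1 / 2)) * \<bar>beta_coeff W ?f l' k'\<bar> \<le> B"
      if "coarse W \<le> l'" "k' \<in> {1..2 ^ l'}" for l' k'
      using pair[OF wavelet_square_integrable[OF that]] wavelet_mean_zero[OF that]
        wavelet_orthonormal[OF l k1 that] B c
      by (auto simp: beta_coeff_def)
    ultimately show ?thesis
      unfolding holder_norm_def by (auto intro!: SUP_least ennreal_leI)
  qed
  ultimately show ?thesis by (simp add: holder_densities_def)
qed

text \<open>This is the perturbation of amplitude \<open>c = 0\<close>.\<close>

lemma uniform_holder:
  assumes "1 \<le> B"
  shows "(\<lambda>_. 1) \<in> holder_densities W B s"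
proof -
  let ?l = "Suc (coarse W)"
  obtain k where k: "k \<in> interior_indices W ?l" using interior_indices_nonempty[OF lessI] by blast
  obtain C where "\<And>x. \<bar>mother W x\<bar> \<le> C" using mother_bounded by auto
  from perturbed_uniform_holder[OF k _ this, of 0 s B] show ?thesis
    using assms by (simp add: perturbed_uniform_def)
qed

text \<open>Duality: at \<open>(l, k)\<close> the perturbed density has coefficient \<open>c\<close>
  and \<open>g\<close> has one of size at most \<open>B * 2 powr (- l * (t + 1 / 2))\<close>, while
  the two differ by at most the sup distance times the \<open>L^1\<close> norm of the wavelet. A sup
  distance below \<open>\<rho>\<close> would contradict the assumed inequality.\<close>

lemma perturbed_uniform_separation:
  assumes k: "k \<in> interior_indices W l" and l: "coarse W \<le> l"
    and C: "\<And>x. \<bar>mother W x\<bar> \<le> C" and "0 \<le> B"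
    and \<rho>: "\<rho> * (2 * real (vmoments W) * C * 2 powr (- real l / 2)) < c - B * 2 powr (- real l * (t + 1 / 2))"
    and \<rho>0: "0 \<le> \<rho>"
    and g: "g \<in> holder_densities W B t"
  shows "ennreal \<rho> \<le> sup_norm (\<lambda>y. g y - perturbed_uniform W l c k y)"
proof (rule ccontr)
  let ?f = "perturbed_uniform W l c k" and ?\<psi> = "wavelet_fun W l k"
  assume "\<not> ennreal \<rho> \<le> sup_norm (\<lambda>y. g y - ?f y)"
  then have less: "sup_norm (\<lambda>y. g y - ?f y) < ennreal \<rho>" by simp
  have diff: "\<bar>g y - ?f y\<bar> \<le> \<rho>" if "y \<in> {0..1}" for y
  proof -
    have "ennreal \<bar>g y - ?f y\<bar> \<le> sup_norm (\<lambda>y. g y - ?f y)"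
      unfolding sup_norm_def using that by (rule SUP_upper)
    with less have "ennreal \<bar>g y - ?f y\<bar> \<le> ennreal \<rho>" by order
    then show ?thesis using \<rho>0 by simp
  qed
  have k1: "k \<in> {1..2 ^ l}" using subsetD[OF interior_indices_subset k] .
  have cont: "continuous_on {0..1} g" using g by (simp add: holder_densities_def)
  have cont\<psi>: "continuous_on {0..1} ?\<psi>" by (rule continuous_wavelet_interior[OF k])
  have contf: "continuous_on {0..1} ?f" unfolding perturbed_uniform_def by (intro continuous_intros cont\<psi>)
  have norm: "holder_norm W t g \<le> ennreal B" using g by (simp add: holder_densities_def)
  have "ennreal (2 powr (real l * (t + 1 / 2)) * \<bar>beta_coeff W g l k\<bar>) \<le> holder_norm W t g"
    unfolding holder_norm_def using l k1 by (intro max.coboundedI2 SUP_upper2[where i = "(l, k)"]) auto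
  with norm have "ennreal (2 powr (real l * (t + 1 / 2)) * \<bar>beta_coeff W g l k\<bar>) \<le> ennreal B" by order
  then have "2 powr (real l * (t + 1 / 2)) * \<bar>beta_coeff W g l k\<bar> \<le> B"
    using \<open>0 \<le> B\<close> by (simp add: ennreal_le_iff)
  then have bg: "\<bar>beta_coeff W g l k\<bar> \<le> B * 2 powr (- real l * (t + 1 / 2))"
    unfolding minus_mult_left[symmetric] powr_minus_divide
    by (simp only: mult_1_right times_divide_eq_right pos_le_divide_eq[OF powr_gt_zero[THEN iffD2]] mult.commute)
  have bf: "(LBINT x:{0..1}. ?f x * ?\<psi> x) = c"
  proof -
    have "(LBINT x:{0..1}. ?f x * ?\<psi> x) = (LBINT x:{0..1}. ?\<psi> x + c * (?\<psi> x * ?\<psi> x))"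
      by (simp add: perturbed_uniform_def algebra_simps)
    also have "\<dots> = (LBINT x:{0..1}. ?\<psi> x) + c * (LBINT x:{0..1}. ?\<psi> x * ?\<psi> x)"
      using cont\<psi> by (simp add: set_integral_add borel_integrable_atLeastAtMost' continuous_on_mult)
    also have "\<dots> = c" using wavelet_mean_zero[OF l k1] wavelet_orthonormal[OF l k1 l k1] by simp
    finally show ?thesis .
  qed
  have i1: "set_integrable lborel {0..1} (\<lambda>x. (?f x - g x) * ?\<psi> x)"
    by (intro borel_integrable_atLeastAtMost' continuous_intros contf cont cont\<psi>)
  have i2: "set_integrable lborel {0..1} (\<lambda>x. \<rho> * \<bar>?\<psi> x\<bar>)"
    by (intro borel_integrable_atLeastAtMost' continuous_intros cont\<psi>)
  have "c - beta_coeff W g l k = (LBINT x:{0..1}. ?f x * ?\<psi> x) - (LBINT x:{0..1}. g x * ?\<psi> x)"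
    by (simp only: bf beta_coeff_def)
  also have "\<dots> = (LBINT x:{0..1}. (?f x - g x) * ?\<psi> x)"
    unfolding left_diff_distrib
    by (rule set_integral_diff(2)[symmetric];
        intro borel_integrable_atLeastAtMost' continuous_on_mult contf cont cont\<psi>)
  also have "\<dots> \<le> (LBINT x:{0..1}. \<rho> * \<bar>?\<psi> x\<bar>)"
  proof (rule set_integral_mono[OF i1 i2])
    fix x :: real assume "x \<in> {0..1}"
    have "(?f x - g x) * ?\<psi> x \<le> \<bar>g x - ?f x\<bar> * \<bar>?\<psi> x\<bar>"
      by (metis abs_ge_self abs_minus_commute abs_mult)
    also have "\<dots> \<le> \<rho> * \<bar>?\<psi> x\<bar>" using diff[OF \<open>x \<in> {0..1}\<close>] by (intro mult_right_mono) auto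
    finally show "(?f x - g x) * ?\<psi> x \<le> \<rho> * \<bar>?\<psi> x\<bar>" .
  qed
  also have "\<dots> = \<rho> * (LBINT x:{0..1}. \<bar>?\<psi> x\<bar>)" by simp
  also have "\<dots> \<le> \<rho> * (2 * real (vmoments W) * C * 2 powr (- real l / 2))"
    by (intro mult_left_mono wavelet_interior_abs_integral k C \<rho>0)
  finally show False using bg \<rho> by linarith
qed

end

section \<open>Testing with a confidence band\<close>

lemma emeasure_density_space:
  assumes "f \<in> borel_measurable M"
  shows "emeasure (density M f) (space M) = (\<integral>\<^sup>+x. f x \<partial>M)"
  using assms by (simp add: emeasure_density cong: nn_integral_cong_simp)

lemma sets_sample_law: "sets (sample_law n f) = sets (sample_algebra n)"
  unfolding sample_law_def sample_algebra_def
  by (intro sets_PiM_cong) (auto intro!: sets_restrict_space_cong)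

lemma prob_space_uniform: "prob_space (restrict_space lborel {0..1::real})"
  by (rule prob_spaceI) (simp add: space_restrict_space emeasure_restrict_space)

lemma sample_law_uniform: "sample_law n (\<lambda>_. 1) = Pi\<^sub>M {1..n} (\<lambda>_. restrict_space lborel {0..1})"
  by (simp add: sample_law_def density_1)

lemma prob_space_sample_law:
  assumes f: "f \<in> holder_densities W B s"
  shows "prob_space (sample_law n f)"
  unfolding sample_law_def
proof (rule prob_space_PiM, rule prob_spaceI)
  let ?\<mu> = "restrict_space lborel {0..1::real}"
  have cont: "continuous_on {0..1} f" and nn: "\<And>x. x \<in> {0..1} \<Longrightarrow> 0 \<le> f x"
    and one: "(LBINT x:{0..1}. f x) = 1"
    using f by (auto simp: holder_densities_def)
  have meas [measurable]: "f \<in> borel_measurable ?\<mu>"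
    using borel_measurable_continuous_on_restrict[OF cont]
    by (simp cong: measurable_cong_sets sets_restrict_space_cong)
  have int: "set_integrable lborel {0..1} f" by (rule borel_integrable_atLeastAtMost'[OF cont])
  have "(\<integral>\<^sup>+x. ennreal (f x) \<partial>?\<mu>) = ennreal (\<integral>x. f x \<partial>?\<mu>)"
    using int nn
    by (intro nn_integral_eq_integral AE_I2)
       (auto simp: integrable_restrict_space set_integrable_def space_restrict_space)
  also have "(\<integral>x. f x \<partial>?\<mu>) = 1"
    using one by (simp add: integral_restrict_space set_lebesgue_integral_def)
  finally show "emeasure (density ?\<mu> (\<lambda>x. ennreal (f x))) (space (density ?\<mu> (\<lambda>x. ennreal (f x)))) = 1"
    by (simp only: space_density emeasure_density_space[of "\<lambda>x. ennreal (f x)" ?\<mu>] measurable_compose[OF meas measurable_ennreal])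
      simp
qed

text \<open>Consider the event that the band covers the uniform density and is narrower than
  \<open>d\<close>. Coverage and Markov give it probability at least
  \<open>\<beta> - \<delta>\<close> under the uniform law. Under each perturbation it has
  probability at most \<open>1 - \<beta>\<close>, since covering both functions at a peak takes
  width \<open>d\<close>. The chi-square bound then forces
  \<open>\<beta> - \<delta> \<le> 1 - \<beta> + \<eta>\<close>.\<close>

lemma band_testing_bound:
  assumes wavelets: "boundary_corrected_daubechies S W" and l: "coarse W < l" and B: "1 \<le> B"
    and C: "\<And>x. \<bar>mother W x\<bar> \<le> C"
    and c: "0 \<le> c" "2 powr (real l * (s + 1 / 2)) * c \<le> B" "c * (2 powr (real l / 2) * C) \<le> 1"
    and band: "confidence_band lo hi"
    and cov0: "\<beta> < coverage_prob lo hi n (\<lambda>_. 1)"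
    and cov: "\<And>k. k \<in> interior_indices W l \<Longrightarrow> \<beta> < coverage_prob lo hi n (perturbed_uniform W l c k)"
    and \<beta>: "0 \<le> \<beta>"
    and diam: "expected_diam lo hi n (\<lambda>_. 1) \<le> ennreal (\<delta> * d)" and d: "0 < d" "0 \<le> \<delta>"
    and peak: "\<And>k. k \<in> interior_indices W l \<Longrightarrow> \<exists>y\<in>{0..1}. d \<le> \<bar>c * wavelet_fun W l k y\<bar>"
    and \<eta>: "0 < \<eta>" "((1 + c\<^sup>2) ^ n - 1) / card (interior_indices W l) \<le> \<eta>\<^sup>2"
  shows "2 * \<beta> \<le> 1 + \<delta> + \<eta>"
proof -
  let ?\<mu> = "restrict_space lborel {0..1::real}" and ?K = "interior_indices W l"
  let ?P0 = "sample_law n (\<lambda>_. 1)" and ?f = "perturbed_uniform W l c"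
  define E where "E f = {X \<in> space (sample_algebra n). \<forall>y\<in>{0..1}. f y \<in> {lo n X y..hi n X y}}" for f :: "real \<Rightarrow> real"
  have space: "space (sample_law n f) = space (sample_algebra n)" for f
    by (rule sets_eq_imp_space_eq[OF sets_sample_law])
  have cov_E: "coverage_prob lo hi n f = measure (sample_law n f) (E f)" for f
    by (simp add: coverage_prob_def E_def space)
  \<comment> \<open>As \<open>measure\<close> is 0 on non-measurable sets, coverage above
    \<open>\<beta> \<ge> 0\<close> yields measurability.\<close>
  have E_sets: "E f \<in> sets (sample_algebra n)" if "\<beta> < coverage_prob lo hi n f" for f
    using that \<beta> measure_notin_sets[of "E f" "sample_law n f"] unfolding cov_E sets_sample_law by force
  interpret P0: prob_space ?P0
    by (rule prob_space_sample_law[OF uniform_holder[OF wavelets B]])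
  \<comment> \<open>the band covers the uniform density but is too narrow to cover any perturbation as well\<close>
  define A where "A = {X \<in> E (\<lambda>_. 1). band_diam lo hi n X < ennreal d}"
  define T where "T = {X \<in> space (sample_algebra n). ennreal d \<le> band_diam lo hi n X}"
  have diam_meas [measurable]: "band_diam lo hi n \<in> borel_measurable (sample_algebra n)"
    using band by (simp add: confidence_band_def)
  have T_sets: "T \<in> sets (sample_algebra n)" unfolding T_def by measurable
  have A_eq: "A = E (\<lambda>_. 1) - T" by (auto simp: A_def T_def E_def)
  have A_sets: "A \<in> sets (sample_algebra n)" unfolding A_eq using T_sets E_sets[OF cov0] by auto
  have "\<beta> - \<delta> \<le> measure ?P0 A"
  proof -
    have dm: "band_diam lo hi n \<in> borel_measurable ?P0"
      using diam_meas by (simp cong: measurable_cong_sets add: measurable_cong_sets[OF sets_sample_law refl])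
    \<comment> \<open>Markov's inequality for the diameter at threshold \<open>d\<close>.\<close>
    have "ennreal d * emeasure ?P0 T \<le> (\<integral>\<^sup>+X. band_diam lo hi n X \<partial>?P0)"
    proof -
      have "ennreal d * emeasure ?P0 T = (\<integral>\<^sup>+X. ennreal d * indicator T X \<partial>?P0)"
        using T_sets by (simp add: nn_integral_cmult_indicator sets_sample_law)
      also have "\<dots> \<le> (\<integral>\<^sup>+X. band_diam lo hi n X \<partial>?P0)"
        by (intro nn_integral_mono) (auto simp: T_def indicator_def)
      finally show ?thesis .
    qed
    also have "\<dots> \<le> ennreal (\<delta> * d)" using diam by (simp add: expected_diam_def)
    finally have "ennreal (d * measure ?P0 T) \<le> ennreal (\<delta> * d)"
      using d by (simp add: P0.emeasure_eq_measure ennreal_mult)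
    then have "d * measure ?P0 T \<le> \<delta> * d"
      using d by (simp add: ennreal_le_iff)
    then have "measure ?P0 T \<le> \<delta>" using d by (simp add: mult.commute)
    moreover have "measure ?P0 (E (\<lambda>_. 1)) \<le> measure ?P0 (A \<union> T)"
      using sets.Un[OF A_sets T_sets] by (intro P0.finite_measure_mono) (auto simp: A_eq sets_sample_law)
    moreover have "measure ?P0 (A \<union> T) \<le> measure ?P0 A + measure ?P0 T"
      using A_sets T_sets by (intro measure_Un_le) (auto simp: sets_sample_law)
    ultimately show ?thesis using cov0 unfolding cov_E by linarith
  qed
  moreover have "measure ?P0 A \<le> (1 - \<beta>) + \<eta>"
    unfolding sample_law_uniform
  proof (rule product_mixture_testing_bound[where K = ?K and h = "\<lambda>k x. c * wavelet_fun W l k x" and v = "c\<^sup>2"])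
    show "prob_space ?\<mu>" by (rule prob_space_uniform)
    show "finite ?K" "?K \<noteq> {}"
      using finite_interior_indices[OF wavelets] interior_indices_nonempty[OF wavelets l] by auto
    show "0 < \<eta>" "((1 + c\<^sup>2) ^ card {1..n} - 1) / card ?K \<le> \<eta>\<^sup>2" using \<eta> by auto
    show "A \<in> sets (Pi\<^sub>M {1..n} (\<lambda>_. ?\<mu>))"
      using A_sets unfolding sample_law_uniform[symmetric] sets_sample_law .
  next
    fix k assume k: "k \<in> ?K"
    have "continuous_on {0..1} (wavelet_fun W l k)" by (rule continuous_wavelet_interior[OF wavelets k])
    from borel_measurable_continuous_on_restrict[OF this]
    have "wavelet_fun W l k \<in> borel_measurable ?\<mu>"
      by (simp cong: measurable_cong_sets sets_restrict_space_cong)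
    then show "(\<lambda>x. c * wavelet_fun W l k x) \<in> borel_measurable ?\<mu>" by simp
    show "\<bar>c * wavelet_fun W l k x\<bar> \<le> 1" for x
    proof -
      have "\<bar>c * wavelet_fun W l k x\<bar> \<le> c * (2 powr (real l / 2) * C)"
        unfolding abs_mult using c wavelet_interior_bound[OF wavelets k C, of x] by (auto intro!: mult_left_mono)
      then show ?thesis using c(3) by linarith
    qed
    have k1: "k \<in> {1..2 ^ l}" by (rule subsetD[OF interior_indices_subset[OF wavelets] k])
    show "(\<integral>x. c * wavelet_fun W l k x \<partial>?\<mu>) = 0"
      using wavelet_mean_zero[OF wavelets _ k1] l
      by (simp add: integral_restrict_space set_lebesgue_integral_def)
    have hold: "?f k \<in> holder_densities W B s"
      by (rule perturbed_uniform_holder[OF wavelets k _ C c B]) (use l in simp)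
    interpret Pk: prob_space "sample_law n (?f k)" by (rule prob_space_sample_law[OF hold])
    have "A \<inter> E (?f k) = {}"
    proof (rule equals0I)
      fix X assume X: "X \<in> A \<inter> E (?f k)"
      obtain y where y: "y \<in> {0..1}" "d \<le> \<bar>c * wavelet_fun W l k y\<bar>" using peak[OF k] by auto
      have "lo n X y \<le> 1" "1 \<le> hi n X y" "lo n X y \<le> ?f k y" "?f k y \<le> hi n X y"
        using X y(1) by (auto simp: A_def E_def)
      then have "d \<le> \<bar>hi n X y - lo n X y\<bar>" using y(2) unfolding perturbed_uniform_def by linarith
      then have "ennreal d \<le> band_diam lo hi n X"
        unfolding band_diam_def using y(1) by (intro SUP_upper2[where i = y]) (auto intro: ennreal_leI)
      then show False using X by (auto simp: A_def)
    qed
    then have "measure (sample_law n (?f k)) A \<le> measure (sample_law n (?f k)) (space (sample_law n (?f k)) - E (?f k))"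
      using E_sets[OF cov[OF k]] A_sets sets.sets_into_space[OF A_sets]
      by (intro Pk.finite_measure_mono) (auto simp: sets_sample_law space)
    also have "\<dots> = 1 - coverage_prob lo hi n (?f k)"
      using E_sets[OF cov[OF k]] by (subst Pk.prob_compl) (auto simp: sets_sample_law cov_E)
    also have "\<dots> \<le> 1 - \<beta>" using cov[OF k] by simp
    finally show "measure (Pi\<^sub>M {1..n} (\<lambda>_. density ?\<mu> (\<lambda>x. ennreal (1 + c * wavelet_fun W l k x)))) A \<le> 1 - \<beta>"
      by (simp add: sample_law_def perturbed_uniform_def)
    fix k' assume k': "k' \<in> ?K"
    have k1': "k' \<in> {1..2 ^ l}" by (rule subsetD[OF interior_indices_subset[OF wavelets] k'])
    have "(\<integral>x. c * wavelet_fun W l k x * (c * wavelet_fun W l k' x) \<partial>?\<mu>)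
        = (LBINT x:{0..1}. c\<^sup>2 * (wavelet_fun W l k x * wavelet_fun W l k' x))"
      by (simp add: integral_restrict_space set_lebesgue_integral_def power2_eq_square ac_simps)
    also have "\<dots> = c\<^sup>2 * (LBINT x:{0..1}. wavelet_fun W l k x * wavelet_fun W l k' x)"
      by (rule set_integral_mult_right)
    also have "\<dots> = (if k = k' then c\<^sup>2 else 0)"
      using l by (subst wavelet_orthonormal[OF wavelets _ k1 _ k1']) auto
    finally show "(\<integral>x. c * wavelet_fun W l k x * (c * wavelet_fun W l k' x) \<partial>?\<mu>) = (if k = k' then c\<^sup>2 else 0)" .
  qed simp
  ultimately show ?thesis by linarith
qed

section \<open>Grid and rates\<close>

text \<open>The first step after \<open>s\<close> already contributes \<open>\<zeta> / ln n\<close>,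
  and by monotonicity the later steps only increase the distance.\<close>

lemma smoothness_grid_gap:
  assumes "smoothness_grid r R \<zeta> n G" "s \<in> G" "t \<in> G" "s < t"
  shows "\<zeta> / ln (real n) \<le> t - s"
proof -
  obtain m \<sigma> where G: "G = \<sigma> ` {1..m}"
    and step: "\<And>i. i \<in> {1..<m} \<Longrightarrow> \<sigma> i < \<sigma> (Suc i) \<and> \<zeta> / ln (real n) \<le> \<sigma> (Suc i) - \<sigma> i"
    using assms(1) by (auto simp: smoothness_grid_def)
  have gap: "j \<le> m \<Longrightarrow> \<sigma> i < \<sigma> j \<and> \<zeta> / ln (real n) \<le> \<sigma> j - \<sigma> i" if "1 \<le> i" "Suc i \<le> j" for i j
    using that(2)
  proof (induction j rule: dec_induct)
    case base
    then show ?case using step[of i] that by auto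
  next
    case (step k)
    then show ?case using \<open>1 \<le> i\<close> \<open>\<And>i. i \<in> {1..<m} \<Longrightarrow> _ i\<close>[of k] by fastforce
  qed
  obtain i j where ij: "i \<in> {1..m}" "j \<in> {1..m}" "s = \<sigma> i" "t = \<sigma> j" using assms G by auto
  have "i < j"
  proof (rule ccontr)
    assume "\<not> i < j"
    then have "i = j \<or> Suc j \<le> i" by auto
    then show False using gap[of j i] ij \<open>s < t\<close> by auto
  qed
  then show ?thesis using gap[of i j] ij by auto
qed

lemma smoothness_grid_subset:
  assumes "smoothness_grid r R \<zeta> n G"
  shows "G \<subseteq> {r..R}"
proof -
  obtain m \<sigma> where G: "G = \<sigma> ` {1..m}" "\<sigma> 1 = r" "\<sigma> m = R"
    and step: "\<And>i. i \<in> {1..<m} \<Longrightarrow> \<sigma> i < \<sigma> (Suc i)"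
    using assms by (auto simp: smoothness_grid_def)
  have mono: "j \<le> m \<Longrightarrow> \<sigma> i \<le> \<sigma> j" if "1 \<le> i" "i \<le> j" for i j
    using that(2)
  proof (induction j rule: dec_induct)
    case (step k)
    then show ?case using \<open>1 \<le> i\<close> \<open>\<And>i. i \<in> {1..<m} \<Longrightarrow> _ i\<close>[of k] by fastforce
  qed simp
  show ?thesis using mono[of 1] mono[of _ m] G by auto
qed

section \<open>Dyadic resolution level and comparison of rates\<close>

lemma ex_dyadic_between:
  assumes "1 \<le> (x :: real)"
  shows "\<exists>l. x \<le> 2 ^ l \<and> 2 ^ l \<le> 2 * x"
proof -
  define l where "l = nat \<lceil>log 2 x\<rceil>"
  have "0 \<le> log 2 x" using assms by simp
  then have l: "log 2 x \<le> real l" "real l \<le> log 2 x + 1" unfolding l_def by linarith+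
  have x: "x = 2 powr (log 2 x)" using assms by simp
  have "2 powr (log 2 x) \<le> 2 powr (real l)" using l by simp
  moreover have "2 powr (real l) \<le> 2 powr (log 2 x + 1)" using l by simp
  ultimately show ?thesis using x by (auto simp: powr_add powr_realpow intro!: exI[of _ l])
qed

text \<open>Since \<open>u = n / ln n\<close> is at least \<open>sqrt n\<close>, its logarithm is at
  least \<open>ln n / 2\<close>, which cancels the \<open>1 / ln n\<close> of the grid spacing. This
  is how \<open>\<zeta>\<close> turns into an exponentially small constant factor.\<close>

lemma powr_gap_le_exp:
  assumes n: "0 < ln (real n)" "sqrt (real n) \<le> real n / ln (real n)"
    and g: "p * (\<zeta> / ln (real n)) \<le> g" and "0 \<le> p" "0 \<le> \<zeta>"
  shows "(real n / ln (real n)) powr (- g) \<le> exp (- (p * \<zeta> / 2))"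
proof -
  let ?u = "real n / ln (real n)"
  \<comment> \<open>A positive logarithm also excludes \<open>n = 0\<close>, since
    \<open>ln 0 = 0\<close>.\<close>
  have n0: "1 < real n" using n(1) by (cases n) (auto intro: gr0I)
  then have u: "0 < ?u" using n by simp
  have "ln (sqrt (real n)) \<le> ln ?u" using n n0 u by (subst ln_le_cancel_iff) auto
  then have lu: "ln (real n) / 2 \<le> ln ?u" using n0 by (simp add: ln_sqrt)
  have "p * \<zeta> / 2 = p * (\<zeta> / ln (real n)) * (ln (real n) / 2)" using n by simp
  also have "\<dots> \<le> g * (ln (real n) / 2)" using g n by (intro mult_right_mono) auto
  also have "\<dots> \<le> g * ln ?u"
  proof (rule mult_left_mono[OF lu])
    have "0 \<le> p * (\<zeta> / ln (real n))" using assms by simp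
    with g show "0 \<le> g" by linarith
  qed
  finally show ?thesis using u by (simp add: powr_def)
qed

lemma rate_eq:
  assumes "1 < n"
  shows "rate n s = (real n / ln (real n)) powr (- (s / (2 * s + 1)))"
proof -
  have "ln (real n) / real n = inverse (real n / ln (real n))" by simp
  moreover have "0 < real n / ln (real n)" using assms by simp
  ultimately show ?thesis unfolding rate_def by (simp only: powr_minus inverse_powr)
qed

text \<open>The exponents of the two rates differ by
  \<open>(s' - s) / ((2 * s' + 1) * (2 * s + 1))\<close>, which is at least
  \<open>(s' - s) / (2 * R + 1)^2\<close>.\<close>

lemma rate_gap:
  assumes n: "0 < ln (real n)" "sqrt (real n) \<le> real n / ln (real n)"
    and s: "0 < s" "s < s'" "s' \<le> R" and gap: "\<zeta> / ln (real n) \<le> s' - s" and "0 \<le> \<zeta>"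
  shows "rate n s' \<le> exp (- (\<zeta> / (2 * (2 * R + 1)\<^sup>2))) * rate n s"
proof -
  let ?u = "real n / ln (real n)" and ?p = "1 / (2 * R + 1)\<^sup>2"
  have n1: "1 < n" using n(1) by (cases n) (auto intro: gr0I)
  have "?p * (\<zeta> / ln (real n)) \<le> ?p * (s' - s)" by (rule mult_left_mono[OF gap]) simp
  also have "\<dots> \<le> 1 / ((2 * s' + 1) * (2 * s + 1)) * (s' - s)"
    using s unfolding power2_eq_square
    by (intro mult_right_mono divide_left_mono mult_mono mult_pos_pos) auto
  also have "\<dots> = s' / (2 * s' + 1) - s / (2 * s + 1)"
    using s by (simp add: field_simps)
  finally have g: "?p * (\<zeta> / ln (real n)) \<le> s' / (2 * s' + 1) - s / (2 * s + 1)" .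
  have "rate n s' = ?u powr (- (s' / (2 * s' + 1) - s / (2 * s + 1))) * rate n s"
    unfolding rate_eq[OF n1] powr_add[symmetric] by simp
  also have "\<dots> \<le> exp (- (?p * \<zeta> / 2)) * rate n s"
    by (intro mult_right_mono powr_gap_le_exp n g) (auto simp: rate_def \<open>0 \<le> \<zeta>\<close>)
  finally show ?thesis by (simp add: mult.commute)
qed

text \<open>All four bounds come from \<open>2 ^ l\<close> being within a factor 2 of
  \<open>u powr (1 / (2 * s + 1))\<close>, where \<open>u = n / ln n\<close>. In order: perturbation
  heights are at least of the order of the rate, squared amplitudes are of order at most
  \<open>ln n / n\<close>, the number of positions is at least a power of \<open>n\<close>, and
  coefficients of smoother balls are damped exponentially in \<open>\<zeta>\<close>.\<close>

lemma level_bounds: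
  assumes n: "0 < ln (real n)" "sqrt (real n) \<le> real n / ln (real n)"
    and s: "0 < s" "s \<le> R"
    and l: "(real n / ln (real n)) powr (1 / (2 * s + 1)) \<le> 2 ^ l"
      "2 ^ l \<le> 2 * (real n / ln (real n)) powr (1 / (2 * s + 1))"
  shows "2 powr (- R) * rate n s \<le> 2 powr (- (real l * s))"
    and "2 powr (- (real l * (2 * s + 1))) \<le> ln (real n) / real n"
    and "real n powr (1 / (2 * (2 * R + 1))) \<le> 2 ^ l"
    and "0 \<le> \<zeta> \<Longrightarrow> \<zeta> / ln (real n) \<le> t - s \<Longrightarrow>
      2 powr (- (real l * (t - s))) \<le> exp (- (\<zeta> / (2 * (2 * R + 1)\<^sup>2)))"
proof -
  define u where "u = real n / ln (real n)"
  define x where "x = u powr (1 / (2 * s + 1))"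
  have n1: "1 < n" using n(1) by (cases n) (auto intro: gr0I)
  have u: "0 < u" unfolding u_def using n n1 by simp
  have x0: "0 < x" unfolding x_def using u by simp
  have x: "x \<le> 2 ^ l" "2 ^ l \<le> 2 * x" using l by (auto simp: x_def u_def)
  have pow: "2 powr (- (real l * a)) = (2 ^ l) powr (- a)" for a
    by (simp add: powr_realpow[symmetric] powr_powr)
  have xpow: "x powr (- a) = u powr (- (a / (2 * s + 1)))" for a
    by (simp add: x_def powr_powr)
  have le: "2 powr (- (real l * a)) \<le> u powr (- (a / (2 * s + 1)))" if "0 \<le> a" for a
    unfolding pow xpow[symmetric] using x x0 that by (intro powr_mono2') auto
  show "2 powr (- R) * rate n s \<le> 2 powr (- (real l * s))"
  proof -
    have "2 powr (- R) * rate n s \<le> 2 powr (- s) * rate n s"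
      using s by (intro mult_right_mono) (auto simp: rate_def)
    also have "\<dots> = (2 * x) powr (- s)"
      using x0 by (simp add: powr_mult xpow rate_eq[OF n1] u_def)
    also have "\<dots> \<le> 2 powr (- (real l * s))"
      unfolding pow using x s by (intro powr_mono2') auto
    finally show ?thesis .
  qed
  show "2 powr (- (real l * (2 * s + 1))) \<le> ln (real n) / real n"
  proof -
    have "(2 * s + 1) / (2 * s + 1) = 1" using s by simp
    moreover have "u powr (- 1) = 1 / u" using u by (simp add: powr_minus_divide)
    moreover have "1 / u = ln (real n) / real n" by (simp add: u_def)
    ultimately show ?thesis using le[of "2 * s + 1"] s by simp
  qed
  show "real n powr (1 / (2 * (2 * R + 1))) \<le> 2 ^ l"
  proof -
    have "real n powr (1 / (2 * (2 * R + 1))) = sqrt (real n) powr (1 / (2 * R + 1))"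
      by (simp add: powr_half_sqrt[symmetric] powr_powr)
    also have "\<dots> \<le> sqrt (real n) powr (1 / (2 * s + 1))"
      using n1 s by (intro powr_mono) (auto simp: frac_le)
    also have "\<dots> \<le> x" unfolding x_def u_def using n s by (intro powr_mono2) auto
    finally show ?thesis using x by linarith
  qed
  assume \<zeta>: "0 \<le> \<zeta>" and gap: "\<zeta> / ln (real n) \<le> t - s"
  have "0 \<le> \<zeta> / ln (real n)" using \<zeta> n by simp
  with gap have ts: "0 \<le> t - s" by linarith
  \<comment> \<open>This crude bound is taken to obtain the same exponential factor as in
    \<open>rate_gap\<close>, so that one choice of \<open>\<zeta>\<close> serves both.\<close>
  have "2 * s + 1 \<le> (2 * R + 1) * (2 * R + 1)"
    using s mult_mono[of "2 * s + 1" "2 * R + 1" 1 "2 * R + 1"] by simp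
  then have "1 / (2 * R + 1)\<^sup>2 \<le> 1 / (2 * s + 1)"
    using s unfolding power2_eq_square by (intro divide_left_mono) auto
  with gap ts have "1 / (2 * R + 1)\<^sup>2 * (\<zeta> / ln (real n)) \<le> 1 / (2 * s + 1) * (t - s)"
    using \<zeta> n s by (intro mult_mono) auto
  from powr_gap_le_exp[OF n this _ \<zeta>] le[OF ts]
  show "2 powr (- (real l * (t - s))) \<le> exp (- (\<zeta> / (2 * (2 * R + 1)\<^sup>2)))"
    by (simp add: u_def mult.commute)
qed

text \<open>With \<open>q = 1 / (4 * (2 * R + 1))\<close>, one has
  \<open>(1 + v) ^ n \<le> exp (n * v) \<le> n powr q\<close>, while \<open>N\<close> is at least
  \<open>n powr (2 * q) / 2\<close>: the number of alternatives outgrows the second moments.\<close>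

lemma chi_square_bound:
  assumes n: "1 < n" and R: "0 < R" and \<epsilon>: "\<epsilon>\<^sup>2 \<le> 1 / (4 * (2 * R + 1))"
    and v: "0 \<le> v" "v \<le> \<epsilon>\<^sup>2 * (ln (real n) / real n)"
    and N: "real n powr (1 / (2 * (2 * R + 1))) \<le> 2 * N"
  shows "((1 + v) ^ n - 1) / N \<le> 2 * real n powr (- (1 / (4 * (2 * R + 1))))"
proof -
  define q where "q = 1 / (4 * (2 * R + 1))"
  have q: "0 < q" unfolding q_def using R by simp
  have q2: "1 / (2 * (2 * R + 1)) = q + q" unfolding q_def using R by (simp add: field_simps)
  have n0: "0 < real n" "0 < ln (real n)" using n by auto
  have "0 < real n powr (q + q)" using n0 by simp
  then have N0: "0 < N" using N unfolding q2 by linarith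
  have "(1 + v) ^ n \<le> exp v ^ n" using v(1) exp_ge_add_one_self[of v] by (intro power_mono) auto
  also have "\<dots> = exp (real n * v)" by (simp add: exp_of_nat_mult)
  also have "\<dots> \<le> exp (q * ln (real n))"
  proof -
    have "real n * v \<le> real n * (\<epsilon>\<^sup>2 * (ln (real n) / real n))" using v n0 by (intro mult_left_mono) auto
    also have "\<dots> = \<epsilon>\<^sup>2 * ln (real n)" using n0 by simp
    also have "\<dots> \<le> q * ln (real n)" unfolding q_def using \<epsilon> n0 by (intro mult_right_mono) auto
    finally show ?thesis by simp
  qed
  also have "\<dots> = real n powr q" using n0 by (simp add: powr_def)
  finally have "(1 + v) ^ n - 1 \<le> real n powr q" by simp
  then have "((1 + v) ^ n - 1) / N \<le> real n powr q / (real n powr (q + q) / 2)"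
    using N n0 N0 unfolding q2 by (intro frac_le) auto
  also have "\<dots> = 2 * real n powr (- q)"
    unfolding powr_add powr_minus using n0 by (simp add: field_simps)
  finally show ?thesis unfolding q_def .
qed

section \<open>Choice of the constants and the contradiction\<close>

theorem theorem3:
  fixes W :: wavelet_system and S :: nat and R B L \<alpha> :: real
  assumes "boundary_corrected_daubechies S W"
    and "R < real S" and "1 \<le> B" and "1 \<le> L" and "0 < \<alpha>" and "\<alpha> < 1 / 3"
  shows "\<exists>\<zeta>\<^sub>0>0. \<forall>\<zeta>\<ge>\<zeta>\<^sub>0. \<forall>(r::real) (G :: nat \<Rightarrow> real set) (s :: nat \<Rightarrow> real) (s' :: nat \<Rightarrow> real)
           (\<rho> :: nat \<Rightarrow> real \<Rightarrow> real) (lo :: band_end) (hi :: band_end).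
     0 < r \<longrightarrow> r < R \<longrightarrow>
     (\<forall>\<^sub>F n in sequentially. smoothness_grid r R \<zeta> n (G n)) \<longrightarrow>
     (\<forall>\<^sub>F n in sequentially. s n \<in> G n \<and> s' n \<in> G n \<and> s n < s' n) \<longrightarrow>
     (\<forall>n t. 0 \<le> \<rho> n t) \<longrightarrow>
     confidence_band lo hi \<longrightarrow>
     asymp_honest lo hi \<alpha>
       (\<lambda>n. holder_densities W B (s' n) \<union> separated_densities W B (s n) (\<rho> n (s n)) (G n)) \<longrightarrow>
     (\<forall>\<^sub>F n in sequentially.
        (SUP f\<in>holder_densities W B (s' n). expected_diam lo hi n f)
          \<le> ennreal (L * rate n (s' n)) \<and>
        (SUP f\<in>separated_densities W B (s n) (\<rho> n (s n)) (G n). expected_diam lo hi n f)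
          \<le> ennreal (L * rate n (s n))) \<longrightarrow>
     liminf (\<lambda>n. ereal (\<rho> n (s n) / rate n (s n))) > 0"
\<comment> \<open>For \<open>R \<le> 0\<close> no \<open>r\<close> satisfies
  \<open>0 < r < R\<close>.\<close>
proof (cases "0 < R")
  case False
  then show ?thesis by (intro exI[of _ 1]) auto
next
  case R: True
  note wavelets = assms(1) and B = assms(3)
  let ?Q = "2 * R + 1"
  obtain C where C: "0 < C" "\<And>x. \<bar>mother W x\<bar> \<le> C" using mother_bounded[OF wavelets] by auto
  obtain x\<^sub>0 where x\<^sub>0: "mother W x\<^sub>0 \<noteq> 0" using mother_nonzero[OF wavelets] by auto
  \<comment> \<open>\<open>D\<close> is the \<open>L^1\<close> bound for interior wavelets without
    its factor \<open>2 powr (- l / 2)\<close>.\<close>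
  define D where "D = 2 * real (vmoments W) * C"
  have D: "0 < D" using vmoments_pos[OF wavelets] C by (simp add: D_def)
  \<comment> \<open>the last bound makes \<open>n powr \<epsilon>\<^sup>2\<close> of smaller order than the number of perturbations\<close>
  define \<epsilon> where "\<epsilon> = min 1 (min (1 / C) (sqrt (1 / (4 * ?Q))))"
  have \<epsilon>: "0 < \<epsilon>" "\<epsilon> \<le> 1" "\<epsilon> \<le> 1 / C" "\<epsilon> \<le> sqrt (1 / (4 * ?Q))"
    using C R by (auto simp: \<epsilon>_def)
  have \<epsilon>C: "\<epsilon> * C \<le> 1" using \<epsilon>(3) C by (simp add: field_simps)
  have \<epsilon>2: "\<epsilon>\<^sup>2 \<le> 1 / (4 * ?Q)"
    using power_mono[OF \<epsilon>(4), of 2] \<epsilon>(1) R by simp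
  \<comment> \<open>\<open>a * rate n s\<close> will serve as the width \<open>d\<close>: it bounds
    the peak height of every perturbation from below.\<close>
  define a where "a = \<epsilon> * \<bar>mother W x\<^sub>0\<bar> * 2 powr (- R)"
  have a: "0 < a" using \<epsilon> x\<^sub>0 by (simp add: a_def)
  \<comment> \<open>The first bound shrinks \<open>L * rate n s'\<close> to \<open>a / 24\<close>
    times the rate at \<open>s\<close>; the second makes the level-\<open>l\<close> coefficients of
    smoother densities at most half of \<open>c\<close>.\<close>
  define \<kappa> where "\<kappa> = min (a / (24 * L)) (\<epsilon> / (2 * B))"
  have \<kappa>: "0 < \<kappa>" "\<kappa> \<le> a / (24 * L)" "\<kappa> \<le> \<epsilon> / (2 * B)" using a \<epsilon> assms by (auto simp: \<kappa>_def)
  \<comment> \<open>This solves \<open>exp (- \<zeta> / (2 * ?Q^2)) \<le> \<kappa>\<close> for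
    \<open>\<zeta>\<close>. It is fixed before \<open>r\<close>, the grids and the band, hence
    uniform in them; the \<open>max\<close> keeps it positive.\<close>
  define \<zeta>\<^sub>0 where "\<zeta>\<^sub>0 = max 1 (- (2 * ?Q\<^sup>2) * ln \<kappa>)"
  have \<zeta>\<^sub>0: "exp (- (\<zeta> / (2 * ?Q\<^sup>2))) \<le> \<kappa>" if "\<zeta>\<^sub>0 \<le> \<zeta>" for \<zeta>
  proof -
    have "- (2 * ?Q\<^sup>2) * ln \<kappa> \<le> \<zeta>" using that by (simp add: \<zeta>\<^sub>0_def)
    then have "- (\<zeta> / (2 * ?Q\<^sup>2)) \<le> ln \<kappa>" using R by (simp add: field_simps)
    then show ?thesis using \<kappa>(1) by (metis exp_le_cancel_iff exp_ln)
  qed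
  \<comment> \<open>The lower bound for the liminf: \<open>\<rho> < b * rate\<close> gives
    \<open>\<rho> * D < \<epsilon> / 2 * 2 powr (- R) * rate\<close>, which fits into the half of
    the coefficient left over by \<open>\<kappa>\<close>.\<close>
  define b where "b = \<epsilon> * 2 powr (- R) / (2 * D)"
  have b: "0 < b" using \<epsilon> D by (simp add: b_def)
  show ?thesis
  proof (intro exI[of _ \<zeta>\<^sub>0] conjI allI impI)
    show "0 < \<zeta>\<^sub>0" by (simp add: \<zeta>\<^sub>0_def)
    fix \<zeta> r :: real and G :: "nat \<Rightarrow> real set" and s s' :: "nat \<Rightarrow> real"
      and \<rho> :: "nat \<Rightarrow> real \<Rightarrow> real" and lo hi :: band_end
    assume \<zeta>: "\<zeta>\<^sub>0 \<le> \<zeta>" and r: "0 < r" "r < R"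
      and grid: "\<forall>\<^sub>F n in sequentially. smoothness_grid r R \<zeta> n (G n)"
      and s: "\<forall>\<^sub>F n in sequentially. s n \<in> G n \<and> s' n \<in> G n \<and> s n < s' n"
      and \<rho>: "\<forall>n t. 0 \<le> \<rho> n t" and band: "confidence_band lo hi"
      and honest: "asymp_honest lo hi \<alpha>
        (\<lambda>n. holder_densities W B (s' n) \<union> separated_densities W B (s n) (\<rho> n (s n)) (G n))"
      and adaptive: "\<forall>\<^sub>F n in sequentially.
        (SUP f\<in>holder_densities W B (s' n). expected_diam lo hi n f) \<le> ennreal (L * rate n (s' n)) \<and>
        (SUP f\<in>separated_densities W B (s n) (\<rho> n (s n)) (G n). expected_diam lo hi n f)
          \<le> ennreal (L * rate n (s n))"
    have \<zeta>pos: "0 \<le> \<zeta>" using \<zeta> by (simp add: \<zeta>\<^sub>0_def)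
    \<comment> \<open>A liminf ensures coverage only above levels strictly below
      \<open>1 - \<alpha>\<close>, whence a slack of 1/24. Another 1/24 is spent on the diameter and
      1/5 on the chi-square distance.\<close>
    let ?\<beta> = "1 - \<alpha> - 1 / 24"
    have "ereal ?\<beta> < ereal (1 - \<alpha>)" by simp
    also have "\<dots> \<le> liminf (\<lambda>n. INF f\<in>holder_densities W B (s' n) \<union>
        separated_densities W B (s n) (\<rho> n (s n)) (G n). ereal (coverage_prob lo hi n f))"
      using honest by (simp add: asymp_honest_def)
    finally have cov: "\<forall>\<^sub>F n in sequentially. ereal ?\<beta> < (INF f\<in>holder_densities W B (s' n) \<union>
        separated_densities W B (s n) (\<rho> n (s n)) (G n). ereal (coverage_prob lo hi n f))"
      by (rule less_LiminfD)
    have large: "\<forall>\<^sub>F n in sequentially. 0 < ln (real n)"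
      "\<forall>\<^sub>F n in sequentially. sqrt (real n) \<le> real n / ln (real n)"
      by real_asymp+
    have q: "0 < 1 / (4 * ?Q)" "0 < 1 / (2 * ?Q)" using R by auto
    have "((\<lambda>n. 2 * real n powr (- (1 / (4 * ?Q)))) \<longlongrightarrow> 0) sequentially"
      using q by real_asymp
    then have small: "\<forall>\<^sub>F n in sequentially. 2 * real n powr (- (1 / (4 * ?Q))) < (1 / 5)\<^sup>2"
      by (rule order_tendstoD) simp
    have "filterlim (\<lambda>n. real n powr (1 / (2 * ?Q))) at_top sequentially"
      using q by real_asymp
    then have level: "\<forall>\<^sub>F n in sequentially. 2 ^ coarse W < real n powr (1 / (2 * ?Q))"
      by (simp add: filterlim_at_top_dense)
    have "\<forall>\<^sub>F n in sequentially. b \<le> \<rho> n (s n) / rate n (s n)"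
      using grid s adaptive cov large small level
    proof eventually_elim
      case (elim n)
      note n = elim(5,6)
      have n1: "1 < n" using n(1) by (cases n) (auto intro: gr0I)
      have rate0: "0 < rate n t" for t using n n1 by (simp add: rate_def)
      have sR: "0 < s n" "s n < s' n" "s' n \<le> R"
        using smoothness_grid_subset[OF elim(1)] elim(2) r by auto
      let ?x = "(real n / ln (real n)) powr (1 / (2 * s n + 1))"
      have "1 \<le> sqrt (real n)" using n1 by simp
      then have "1 \<le> real n / ln (real n)" using n by linarith
      then have "1 \<le> ?x" using sR by (intro ge_one_powr_ge_zero) auto
      then obtain l where l: "?x \<le> 2 ^ l" "2 ^ l \<le> 2 * ?x" using ex_dyadic_between by blast
      note lb = level_bounds[OF n sR(1) less_imp_le[OF less_le_trans[OF sR(2,3)]] l]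
      \<comment> \<open>The level lies strictly above the coarsest one, so at least half of the
        positions are interior.\<close>
      have "(2 :: real) ^ coarse W < 2 ^ l" using elim(8) lb(3) by linarith
      then have lc: "coarse W < l" by simp
      \<comment> \<open>The amplitude is normalised so that the weighted coefficient in the Hoelder
        norm equals \<open>\<epsilon>\<close>.\<close>
      define c where "c = \<epsilon> * 2 powr (- (real l * (s n + 1 / 2)))"
      have c0: "0 \<le> c" using \<epsilon> by (simp add: c_def)
      have cnorm: "2 powr (real l * (s n + 1 / 2)) * c = \<epsilon>"
        by (simp add: c_def powr_minus)
      have cl: "c * 2 powr (real l / 2) = \<epsilon> * 2 powr (- (real l * s n))"
        unfolding c_def mult.assoc powr_add[symmetric] by (simp add: algebra_simps)
      have csq: "c\<^sup>2 = \<epsilon>\<^sup>2 * 2 powr (- (real l * (2 * s n + 1)))"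
      proof -
        have "- (real l * (s n + 1 / 2)) + - (real l * (s n + 1 / 2)) = - (real l * (2 * s n + 1))"
          by (simp add: field_simps)
        then show ?thesis
          by (simp only: c_def power_mult_distrib power2_eq_square[of "2 powr _"] powr_add[symmetric])
      qed
      have "2 powr (- (real l * s n)) \<le> 1"
        using sR powr_mono[of "- (real l * s n)" 0 2] by simp
      then have cC: "c * (2 powr (real l / 2) * C) \<le> 1"
        using \<epsilon>C \<epsilon> C cl mult_mono[of "2 powr (- (real l * s n))" 1 "\<epsilon> * C" 1] by (simp add: mult_ac)
      have cB: "2 powr (real l * (s n + 1 / 2)) * c \<le> B" using cnorm \<epsilon> B by simp
      show "b \<le> \<rho> n (s n) / rate n (s n)"
      proof (rule ccontr)
        assume "\<not> b \<le> \<rho> n (s n) / rate n (s n)"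
        then have \<rho>_small: "\<rho> n (s n) < b * rate n (s n)"
          using rate0 by (simp add: field_simps not_le)
        \<comment> \<open>A small \<open>\<rho>\<close> enlarges the separated class until it
          contains all perturbations, so that honesty applies to them.\<close>
        have sep: "perturbed_uniform W l c k \<in> separated_densities W B (s n) (\<rho> n (s n)) (G n)"
          if k: "k \<in> interior_indices W l" for k
          unfolding separated_densities_def
        proof (intro CollectI conjI ballI impI INF_greatest)
          show "perturbed_uniform W l c k \<in> holder_densities W B (s n)"
            by (rule perturbed_uniform_holder[OF wavelets k less_imp_le[OF lc] C(2) c0 cB cC B])
          fix t g assume t: "t \<in> G n" "s n < t" and g: "g \<in> holder_densities W B t"
          have gap: "\<zeta> / ln (real n) \<le> t - s n" using smoothness_grid_gap[OF elim(1)] elim(2) t by blast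
          have "2 powr (- (real l * (t - s n))) \<le> \<epsilon> / (2 * B)"
            using lb(4)[OF \<zeta>pos gap] \<zeta>\<^sub>0[OF \<zeta>] \<kappa>(3) by linarith
          then have "B * 2 powr (- (real l * (t - s n))) \<le> \<epsilon> / 2"
            using B by (simp add: field_simps)
          then have "B * 2 powr (- (real l * (t - s n))) * 2 powr (- (real l * s n))
              \<le> \<epsilon> / 2 * 2 powr (- (real l * s n))"
            by (intro mult_right_mono) auto
          then have "B * 2 powr (- (real l * t)) \<le> \<epsilon> / 2 * 2 powr (- (real l * s n))"
            unfolding mult.assoc powr_add[symmetric] by (simp add: algebra_simps)
          moreover have "\<rho> n (s n) * D < \<epsilon> / 2 * 2 powr (- (real l * s n))"
          proof -
            have "\<rho> n (s n) * D < b * rate n (s n) * D" using \<rho>_small D by simp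
            also have "\<dots> = \<epsilon> / 2 * (2 powr (- R) * rate n (s n))" using D by (simp add: b_def)
            also have "\<dots> \<le> \<epsilon> / 2 * 2 powr (- (real l * s n))"
              using lb(1) \<epsilon> by (intro mult_left_mono) auto
            finally show ?thesis .
          qed
          \<comment> \<open>The two halves add up to \<open>c * 2 powr (l / 2)\<close>. Multiplying
            by \<open>2 powr (- l / 2)\<close> then gives the hypothesis of
            \<open>perturbed_uniform_separation\<close>.\<close>
          ultimately have "\<rho> n (s n) * D < c * 2 powr (real l / 2) - B * 2 powr (- (real l * t))"
            unfolding cl by linarith
          then have "\<rho> n (s n) * D * 2 powr (- (real l / 2))
              < (c * 2 powr (real l / 2) - B * 2 powr (- (real l * t))) * 2 powr (- (real l / 2))"
            by (intro mult_strict_right_mono) auto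
          also have "\<dots> = c - B * 2 powr (- real l * (t + 1 / 2))"
            unfolding left_diff_distrib mult.assoc powr_add[symmetric] by (simp add: algebra_simps)
          finally show "ennreal (\<rho> n (s n)) \<le> sup_norm (\<lambda>y. g y - perturbed_uniform W l c k y)"
            using B \<rho> by (intro perturbed_uniform_separation[OF wavelets k less_imp_le[OF lc] C(2) _ _ _ g])
              (auto simp: D_def mult_ac)
        qed
        have covered: "?\<beta> < coverage_prob lo hi n f"
          if "f \<in> holder_densities W B (s' n) \<union> separated_densities W B (s n) (\<rho> n (s n)) (G n)" for f
        proof -
          have "ereal ?\<beta> < ereal (coverage_prob lo hi n f)"
            using elim(4) that by (rule less_INF_D)
          then show ?thesis by simp
        qed
        \<comment> \<open>This amounts to \<open>2 * \<alpha> \<ge> 27 / 40\<close>, which is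
          impossible as \<open>2 * \<alpha> < 2 / 3\<close>.\<close>
        have "2 * ?\<beta> \<le> 1 + 1 / 24 + 1 / 5"
        proof (rule band_testing_bound[OF wavelets lc B C(2) c0 cB cC band,
              where n = n and d = "a * rate n (s n)"])
          show "?\<beta> < coverage_prob lo hi n (\<lambda>_. 1)"
            using uniform_holder[OF wavelets B] by (intro covered) auto
          show "?\<beta> < coverage_prob lo hi n (perturbed_uniform W l c k)"
            if "k \<in> interior_indices W l" for k
            using sep[OF that] by (intro covered) auto
          show "0 \<le> ?\<beta>" using assms by simp
          \<comment> \<open>The uniform density belongs to the smoother class, so adaptivity makes
            its expected diameter a small fraction of the peak height.\<close>
          have "expected_diam lo hi n (\<lambda>_. 1) \<le> ennreal (L * rate n (s' n))"
            using order_trans[OF SUP_upper[OF uniform_holder[OF wavelets B]] conjunct1[OF elim(3)]] .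
          also have "\<dots> \<le> ennreal (1 / 24 * (a * rate n (s n)))"
          proof (rule ennreal_leI)
            have gap: "\<zeta> / ln (real n) \<le> s' n - s n" using smoothness_grid_gap[OF elim(1)] elim(2) by blast
            have "rate n (s' n) \<le> exp (- (\<zeta> / (2 * ?Q\<^sup>2))) * rate n (s n)"
              by (rule rate_gap[OF n sR gap \<zeta>pos])
            also have "\<dots> \<le> a / (24 * L) * rate n (s n)"
              using \<zeta>\<^sub>0[OF \<zeta>] \<kappa>(2) rate0[of "s n"] by (intro mult_right_mono) auto
            finally show "L * rate n (s' n) \<le> 1 / 24 * (a * rate n (s n))"
              using assms(4) by (simp add: field_simps)
          qed
          finally show "expected_diam lo hi n (\<lambda>_. 1) \<le> ennreal (1 / 24 * (a * rate n (s n)))" .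
          show "0 < a * rate n (s n)" using a rate0 by simp
          show "\<exists>y\<in>{0..1}. a * rate n (s n) \<le> \<bar>c * wavelet_fun W l k y\<bar>"
            if k: "k \<in> interior_indices W l" for k
          proof -
            obtain y where y: "y \<in> {0..1}" "wavelet_fun W l k y = 2 powr (real l / 2) * mother W x\<^sub>0"
              using wavelet_interior_peak[OF wavelets k x\<^sub>0] by auto
            have "a * rate n (s n) = \<epsilon> * \<bar>mother W x\<^sub>0\<bar> * (2 powr (- R) * rate n (s n))"
              by (simp add: a_def)
            also have "\<dots> \<le> \<epsilon> * \<bar>mother W x\<^sub>0\<bar> * 2 powr (- (real l * s n))"
              using lb(1) \<epsilon> by (intro mult_left_mono) auto
            also have "\<dots> = c * 2 powr (real l / 2) * \<bar>mother W x\<^sub>0\<bar>" unfolding cl by simp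
            also have "\<dots> = \<bar>c * wavelet_fun W l k y\<bar>" using y c0 by (simp add: abs_mult)
            finally show ?thesis using y by blast
          qed
          have "c\<^sup>2 \<le> \<epsilon>\<^sup>2 * (ln (real n) / real n)"
            unfolding csq using lb(2) by (intro mult_left_mono) auto
          moreover have "real n powr (1 / (2 * ?Q)) \<le> 2 * real (card (interior_indices W l))"
            using lb(3) card_interior_indices[OF wavelets lc] by linarith
          ultimately have "((1 + c\<^sup>2) ^ n - 1) / card (interior_indices W l) \<le> 2 * real n powr (- (1 / (4 * ?Q)))"
            by (intro chi_square_bound[OF n1 R \<epsilon>2]) auto
          then show "((1 + c\<^sup>2) ^ n - 1) / card (interior_indices W l) \<le> (1 / 5)\<^sup>2"
            using elim(7) by linarith
        qed auto
        then show False using assms(6) by simp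
      qed
    qed
    then have "ereal b \<le> liminf (\<lambda>n. ereal (\<rho> n (s n) / rate n (s n)))"
      by (intro Liminf_bounded) (auto elim: eventually_mono)
    with b show "0 < liminf (\<lambda>n. ereal (\<rho> n (s n) / rate n (s n)))"
      by (metis ereal_less(2) less_le_trans)
  qed
qed

end
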